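(* Let $H$ be a graph with $\chi(H)=3$ that contains a critical edge and has odd girth at least $5$. Then ${\delta_{\text{lin-rem}}}(H)\leq\frac14$.
   Context: Copies of $H$ are labeled copies. For $\varepsilon>0$ and $\gamma\in[0,1]$, $\delta(\varepsilon,H;\gamma)$ is the maximum $\delta\in[0,1]$ such that every $n$-vertex graph with minimum degree at least $\gamma n$ containing $\varepsilon n^2$ edge-disjoint copies of $H$ contains at least $\delta n^{v(H)}$ copies of $H$. ${\delta_{\text{lin-rem}}}(H)$ is the infimum of those $\gamma$ for which there is $\mu=\mu(\gamma)>0$ with $\delta(\varepsilon,H;\gamma)\geq\mu\varepsilon$ for all $\varepsilon>0$. An edge $xy$ of $H$ is critical if $\chi(H-xy)<\chi(H)$. The odd girth is the length of a shortest odd cycle.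
   Formalization: In the definition of δ_lin-rem, ε ranges over (0,1] instead of all ε>0: since δ(ε,H;γ)≤1, the bound δ≥με fails for every μ>0 once ε>1/μ, and for ε>1 the condition is vacuous. Host graphs have natural numbers as vertices. *)

theory Defs
  imports
    Complex_Main
    "HOL-Library.Disjoint_Sets"
    "HOL-Library.Extended_Nat"
    "HOL-Library.FuncSet"
    "Graph_Theory.Graph_Theory"
begin

text \<open>
  Finite simple graphs are the symmetric, loop-free digraphs of the locale \<^locale>\<open>pair_graph\<close>:
  an edge \<open>xy\<close> is the pair of arcs \<open>(x, y)\<close>, \<open>(y, x)\<close>, and the degree of a vertex is its
  out-degree.
\<close>

definition proper_colouring :: "'a pair_pre_digraph \<Rightarrow> nat \<Rightarrow> ('a \<Rightarrow> nat) \<Rightarrow> bool" where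
  "proper_colouring G k c \<longleftrightarrow>
     c ` pverts G \<subseteq> {..<k} \<and> (\<forall>(x, y) \<in> parcs G. c x \<noteq> c y)"

definition chromatic_number :: "'a pair_pre_digraph \<Rightarrow> nat" where
  "chromatic_number G = (LEAST k. \<exists>c. proper_colouring G k c)"

definition del_edge :: "'a pair_pre_digraph \<Rightarrow> 'a \<Rightarrow> 'a \<Rightarrow> 'a pair_pre_digraph" where
  "del_edge G x y = G\<lparr>parcs := parcs G - {(x, y), (y, x)}\<rparr>"

definition critical_edge :: "'a pair_pre_digraph \<Rightarrow> 'a \<Rightarrow> 'a \<Rightarrow> bool" where
  "critical_edge G x y \<longleftrightarrow>
     (x, y) \<in> parcs G \<and> chromatic_number (del_edge G x y) < chromatic_number G"

text \<open>
  The library's cycles include the closed walks \<open>x \<rightarrow> y \<rightarrow> x\<close> along a single edge; these have even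
  length, so in a loop-free graph every odd cycle is a genuine one, of length at least 3.
  The odd girth of a graph without odd cycles is \<open>\<infinity>\<close>.
\<close>

definition odd_girth :: "'a pair_pre_digraph \<Rightarrow> enat" where
  "odd_girth G = (INF p \<in> {p. pre_digraph.cycle G p \<and> odd (length p)}. enat (length p))"

definition labelled_copies ::
    "'a pair_pre_digraph \<Rightarrow> 'b pair_pre_digraph \<Rightarrow> ('a \<Rightarrow> 'b) set" where
  "labelled_copies H G =
     {f \<in> pverts H \<rightarrow>\<^sub>E pverts G. inj_on f (pverts H) \<and>
        (\<forall>(x, y) \<in> parcs H. (f x, f y) \<in> parcs G)}"

definition edge_disjoint_copies ::
    "'a pair_pre_digraph \<Rightarrow> 'b pair_pre_digraph \<Rightarrow> ('a \<Rightarrow> 'b) set \<Rightarrow> bool" where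
  "edge_disjoint_copies H G F \<longleftrightarrow>
     F \<subseteq> labelled_copies H G \<and> disjoint_family_on (\<lambda>f. map_prod f f ` parcs H) F"

text \<open>
  Every finite graph is isomorphic to one with vertices in \<^typ>\<open>nat\<close>, so quantifying over graphs
  on \<^typ>\<open>nat\<close> is quantifying over all finite graphs.
\<close>

definition removal_bound ::
    "real \<Rightarrow> 'a pair_pre_digraph \<Rightarrow> real \<Rightarrow> real \<Rightarrow> bool" where
  "removal_bound \<epsilon> H \<gamma> d \<longleftrightarrow>
     (\<forall>(G :: nat pair_pre_digraph) n.
        pair_graph G \<and> card (pverts G) = n \<and>
        (\<forall>v \<in> pverts G. real (out_degree G v) \<ge> \<gamma> * real n) \<and>
        (\<exists>F. edge_disjoint_copies H G F \<and> real (card F) \<ge> \<epsilon> * real n ^ 2)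
        \<longrightarrow> real (card (labelled_copies H G)) \<ge> d * real n ^ card (pverts H))"

definition removal_delta :: "real \<Rightarrow> 'a pair_pre_digraph \<Rightarrow> real \<Rightarrow> real" where
  "removal_delta \<epsilon> H \<gamma> = (GREATEST d. d \<in> {0..1} \<and> removal_bound \<epsilon> H \<gamma> d)"

lemma removal_delta_is_maximum:
  "removal_delta \<epsilon> H \<gamma> \<in> {0..1} \<and> removal_bound \<epsilon> H \<gamma> (removal_delta \<epsilon> H \<gamma>)"
  "d \<in> {0..1} \<Longrightarrow> removal_bound \<epsilon> H \<gamma> d \<Longrightarrow> d \<le> removal_delta \<epsilon> H \<gamma>"
proof -
  let ?P = "\<lambda>d. d \<in> {0..1} \<and> removal_bound \<epsilon> H \<gamma> d"
  let ?S = "Collect ?P"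
  have zero: "0 \<in> ?S" by (auto simp: removal_bound_def)
  have bdd: "bdd_above ?S" by (rule bdd_aboveI[of _ 1]) auto
  have le: "d \<le> Sup ?S" if "?P d" for d using cSup_upper[OF _ bdd, of d] that by simp
  have "removal_bound \<epsilon> H \<gamma> (Sup ?S)"
  proof (rule removal_bound_def[THEN iffD2], intro allI impI)
    fix G :: "nat pair_pre_digraph" and n
    assume G: "pair_graph G \<and> card (pverts G) = n \<and>
      (\<forall>v \<in> pverts G. real (out_degree G v) \<ge> \<gamma> * real n) \<and>
      (\<exists>F. edge_disjoint_copies H G F \<and> real (card F) \<ge> \<epsilon> * real n ^ 2)"
    let ?c = "real (card (labelled_copies H G))" and ?m = "real n ^ card (pverts H)"
    have b: "d * ?m \<le> ?c" if "?P d" for d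
      using that G unfolding removal_bound_def by blast
    show "Sup ?S * ?m \<le> ?c"
    proof (cases "?m = 0")
      case False
      then have m: "?m > 0" by (simp add: zero_less_power)
      have "Sup ?S \<le> ?c / ?m"
      proof (rule cSup_least)
        show "?S \<noteq> {}" using zero by blast
        show "d \<le> ?c / ?m" if "d \<in> ?S" for d
          using b[of d] that m by (simp only: mem_Collect_eq pos_le_divide_eq)
      qed
      then show ?thesis using m by (simp add: pos_le_divide_eq)
    next
      case True
      then show ?thesis by (simp only: mult_zero_right of_nat_0_le_iff)
    qed
  qed
  moreover have "Sup ?S \<in> {0..1}"
    using le[of 0] zero by (auto intro!: cSup_least)
  ultimately have max: "?P (Sup ?S)" by simp
  then have eq: "removal_delta \<epsilon> H \<gamma> = Sup ?S"
    unfolding removal_delta_def by (intro Greatest_equality) (use le in auto)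
  show "removal_delta \<epsilon> H \<gamma> \<in> {0..1} \<and> removal_bound \<epsilon> H \<gamma> (removal_delta \<epsilon> H \<gamma>)"
    "d \<in> {0..1} \<Longrightarrow> removal_bound \<epsilon> H \<gamma> d \<Longrightarrow> d \<le> removal_delta \<epsilon> H \<gamma>"
    using max le unfolding eq by auto
qed

lemma card_edge_disjoint_copies_le:
  assumes "pair_graph G" "parcs H \<noteq> {}" "edge_disjoint_copies H G F"
  shows "card F \<le> card (pverts G) ^ 2"
proof -
  interpret pair_graph G by fact
  from assms(2) obtain x y where xy: "(x, y) \<in> parcs H" by auto
  let ?h = "\<lambda>f. (f x, f y)"
  have "inj_on ?h F"
  proof (rule inj_onI, rule ccontr)
    fix f g assume fg: "f \<in> F" "g \<in> F" "?h f = ?h g" "f \<noteq> g"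
    then have "map_prod f f ` parcs H \<inter> map_prod g g ` parcs H = {}"
      using assms(3) by (auto simp: edge_disjoint_copies_def disjoint_family_on_def)
    moreover have "?h f \<in> map_prod f f ` parcs H" "?h g \<in> map_prod g g ` parcs H"
      using xy by force+
    ultimately show False using fg(3) by (metis IntI empty_iff)
  qed
  moreover have "?h ` F \<subseteq> pverts G \<times> pverts G"
    using assms(3) xy in_arcsD1 in_arcsD2
    by (force simp: edge_disjoint_copies_def labelled_copies_def)
  ultimately have "card F \<le> card (pverts G \<times> pverts G)"
    using pair_finite_verts by (intro card_inj_on_le[of ?h]) auto
  then show ?thesis by (simp add: card_cartesian_product power2_eq_square)
qed

text \<open>
  Only \<open>\<epsilon> \<le> 1\<close> is meaningful. If \<open>H\<close> has an edge then for \<open>\<epsilon> > 1\<close> no nonempty graph contains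
  \<open>\<epsilon> n\<^sup>2\<close> edge-disjoint copies of \<open>H\<close>, so the maximum over \<open>[0,1]\<close> is \<open>1\<close> by default; a bound
  \<open>\<mu> \<epsilon> \<le> 1\<close> for arbitrarily large \<open>\<epsilon>\<close> would then fail for every \<open>\<mu> > 0\<close>. Hence \<open>\<epsilon>\<close> ranges
  over \<open>(0,1]\<close> in the definition of the linear removal threshold.
\<close>

lemma removal_delta_vacuous:
  assumes "pair_graph H" "parcs H \<noteq> {}" "\<epsilon> > 1"
  shows "removal_delta \<epsilon> H \<gamma> = 1"
proof -
  interpret H: pair_graph H by fact
  have H: "card (pverts H) > 0"
    using assms(2) H.pair_finite_verts H.in_arcsD1 by (auto simp: card_gt_0_iff)
  have "removal_bound \<epsilon> H \<gamma> 1"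
    unfolding removal_bound_def
  proof (intro allI impI, elim conjE exE)
    fix G :: "nat pair_pre_digraph" and n F
    assume G: "pair_graph G" "card (pverts G) = n" "edge_disjoint_copies H G F"
      "real (card F) \<ge> \<epsilon> * real n ^ 2"
    have "real (card F) \<le> real n ^ 2"
      using card_edge_disjoint_copies_le[OF G(1) assms(2) G(3)] G(2)
      by (metis of_nat_le_iff of_nat_power)
    then have "\<epsilon> * real n ^ 2 \<le> 1 * real n ^ 2" using G(4) by linarith
    then have "n = 0" using assms(3) by (metis mult_le_cancel_right_pos not_less of_nat_0_less_iff zero_less_power neq0_conv)
    then show "real (card (labelled_copies H G)) \<ge> 1 * real n ^ card (pverts H)"
      using H by (simp add: zero_power)
  qed
  then show ?thesis using removal_delta_is_maximum(1)[of \<epsilon> H \<gamma>] removal_delta_is_maximum(2)[of 1 \<epsilon> H \<gamma>] by force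
qed

definition delta_lin_rem :: "'a pair_pre_digraph \<Rightarrow> real" where
  "delta_lin_rem H =
     Inf {\<gamma> \<in> {0..1}. \<exists>\<mu>>0. \<forall>\<epsilon>. 0 < \<epsilon> \<and> \<epsilon> \<le> 1 \<longrightarrow> removal_delta \<epsilon> H \<gamma> \<ge> \<mu> * \<epsilon>}"

end

theory Submission
  imports Defs
begin

text \<open>
  Let \<open>xy\<close> be a critical edge of \<open>H\<close>. Since \<open>H - xy\<close> is bipartite and \<open>H\<close> is triangle-free, \<open>H\<close> lies in
  the blow-up of a 5-cycle in which \<open>x\<close> and \<open>y\<close> are not blown up; if \<open>xy\<close> lies in no 5-cycle of \<open>H\<close>,
  then the same is true for a 7-cycle. Hence an edge \<open>ab\<close> of the host graph that lies in a positive
  proportion of all possible 5-cycles (or 7-cycles, if \<open>xy\<close> lies in no 5-cycle) plays the role of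
  \<open>xy\<close> in order \<open>n ^ (v(H) - 2)\<close> copies of \<open>H\<close>; call such an edge robust. It is enough to show that
  either a positive proportion of all pairs are robust edges, or every copy of \<open>H\<close> contains a
  robust edge, since edge-disjoint copies then yield different robust edges.

  Minimum degree above \<open>n/4\<close> means that among any four vertices two have linearly many common
  neighbours. If robust edges are rare and a copy of \<open>H\<close> contains none, averaging this over
  suitable quadruples contradicts the existence of a 5-cycle in the copy, or, in the 7-cycle case,
  of any odd closed walk in the copy.
\<close>

section \<open>Complete bipartite subgraphs and walk densities\<close>

text \<open>A single copy of \<open>H\<close> has boundedly many vertices and is negligible in the
  host graph; it can matter only through the neighbourhoods of its vertices, which are large. The
  estimates therefore choose four vertices in or near such neighbourhoods so that a common neighbour
  of any two of them completes a rare walk: a triangle, or a walk of length 4 or 6 between the ends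
  of a non-robust edge. A pair for which this fails needs a bound of its own. The two cases differ
  in which walks yield copies. If \<open>xy\<close> lies in a 5-cycle, \<open>H - xy\<close> has a
  walk of length 4 from \<open>x\<close> to \<open>y\<close>, so it has no pattern on a path of
  length 6; only walks of length 4 may be assumed rare, and the 5-cycle in the copy has to
  compensate. Otherwise walks of length 4 and of length 6 both yield copies, both are rare at
  non-robust edges, and any odd closed walk of \<open>H\<close> will do. Robustness is tested at
  \<open>\<xi>\<^sup>2 / 16\<close> because \<open>codeg_square\<close> then bounds the codegree of
  a non-robust edge by \<open>\<xi>\<close>, so that triangles are rare as well.\<close>

lemma power_mean:
  fixes f :: "'b \<Rightarrow> real"
  assumes "finite S" "S \<noteq> {}" "\<And>x. x \<in> S \<Longrightarrow> 0 \<le> f x"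
  shows "real (card S) * (sum f S / real (card S)) ^ t \<le> (\<Sum>x\<in>S. f x ^ t)"
proof -
  define m where "m = sum f S / real (card S)"
  have c: "real (card S) > 0" using assms by (simp add: card_gt_0_iff)
  have m0: "m \<ge> 0" using assms c by (auto simp: m_def intro!: divide_nonneg_pos sum_nonneg)
  show ?thesis
  proof (cases "m = 0")
    case True
    have "0 \<le> (\<Sum>x\<in>S. f x ^ t)" by (intro sum_nonneg zero_le_power assms(3))
    then show ?thesis unfolding m_def[symmetric] True by (cases "t = 0") (simp_all add: zero_power)
  next
    case False
    with m0 have mp: "m > 0" by simp
    have "m ^ t * (1 + real t * (f x / m - 1)) \<le> f x ^ t" if "x \<in> S" for x
    proof -
      \<comment> \<open>Bernoulli gives the tangent of the power function at the mean
        \<open>m\<close>; summed over \<open>S\<close>, the linear term vanishes.\<close>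
      have "1 + real t * (f x / m - 1) \<le> (1 + (f x / m - 1)) ^ t"
        by (rule Bernoulli_inequality) (use assms(3)[OF that] mp in simp)
      then have "m ^ t * (1 + real t * (f x / m - 1)) \<le> m ^ t * (f x / m) ^ t"
        using mp by (intro mult_left_mono) auto
      also have "\<dots> = f x ^ t" using mp by (simp add: power_divide)
      finally show ?thesis .
    qed
    then have "(\<Sum>x\<in>S. m ^ t * (1 + real t * (f x / m - 1))) \<le> (\<Sum>x\<in>S. f x ^ t)"
      by (rule sum_mono)
    moreover have "(\<Sum>x\<in>S. m ^ t * (1 + real t * (f x / m - 1)))
        = m ^ t * (real (card S) + real t * (sum f S / m - real (card S)))"
      by (simp add: sum_distrib_left[symmetric] sum.distrib sum_subtractf sum_divide_distrib)
    moreover have "sum f S / m = real (card S)" using mp c by (auto simp: m_def zero_less_divide_iff)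
    ultimately show ?thesis by (simp add: m_def mult.commute)
  qed
qed

lemma card_rel_sum:
  assumes "finite X" "finite Y"
  shows "card {(x, y). x \<in> X \<and> y \<in> Y \<and> M x y} = (\<Sum>x\<in>X. card {y \<in> Y. M x y})"
proof -
  have "{(x, y). x \<in> X \<and> y \<in> Y \<and> M x y} = Sigma X (\<lambda>x. {y \<in> Y. M x y})" by auto
  then show ?thesis using assms by simp
qed

lemma sum_card_swap:
  assumes "finite X" "finite Y"
  shows "(\<Sum>x\<in>X. card {y \<in> Y. M x y}) = (\<Sum>y\<in>Y. card {x \<in> X. M x y})"
proof -
  have "(\<Sum>x\<in>X. card {y \<in> Y. M x y}) = (\<Sum>x\<in>X. \<Sum>y\<in>Y. of_bool (M x y))"
    using assms by (auto intro!: sum.cong simp: Int_def)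
  also have "\<dots> = (\<Sum>y\<in>Y. \<Sum>x\<in>X. of_bool (M x y))" by (rule sum.swap)
  also have "\<dots> = (\<Sum>y\<in>Y. card {x \<in> X. M x y})"
    using assms by (auto intro!: sum.cong simp: Int_def)
  finally show ?thesis .
qed

text \<open>Two applications of \<open>power_mean\<close>, as in the Kovari-Sos-Turan argument: over
  \<open>Y\<close>, to count maps from \<open>U\<close> to \<open>X\<close> together with a common
  neighbour, and then over these maps. The two resulting maps are merged into one map to pairs,
  since \<open>hom_count\<close> lets every \<open>u\<close> keep one coordinate of its
  pair.\<close>

lemma complete_bipartite_count:
  fixes M :: "'o \<Rightarrow> 'e \<Rightarrow> bool" and \<eta> :: real
  assumes fin: "finite X" "finite Y" "finite U" and ne: "X \<noteq> {}" "Y \<noteq> {}" and "\<eta> \<ge> 0"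
    and dense: "\<eta> * real (card X * card Y) \<le> real (card {(x, y). x \<in> X \<and> y \<in> Y \<and> M x y})"
  shows "\<eta> ^ (card U * card U) * real (card X * card Y) ^ card U \<le>
    real (card {q \<in> U \<rightarrow>\<^sub>E X \<times> Y. \<forall>u\<in>U. \<forall>u'\<in>U. M (fst (q u)) (snd (q u'))})"
proof -
  define t where "t = card U"
  let ?Xs = "U \<rightarrow>\<^sub>E X" and ?Ys = "U \<rightarrow>\<^sub>E Y"
  define N where "N = (\<lambda>p. card {y \<in> Y. \<forall>u\<in>U. M (p u) y})"
  have finXs: "finite ?Xs" and finYs: "finite ?Ys" using fin by (auto intro: finite_PiE)
  have cXs: "card ?Xs = card X ^ t" using fin by (simp add: card_PiE t_def)
  have x0: "real (card X) > 0" and y0: "real (card Y) > 0"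
    using fin ne by (auto simp: card_gt_0_iff)
  have neXs: "?Xs \<noteq> {}" using ne by (simp add: PiE_eq_empty_iff)
  have "real (card Y) * (\<eta> * real (card X)) ^ t \<le>
      real (card Y) * ((\<Sum>y\<in>Y. real (card {x \<in> X. M x y})) / real (card Y)) ^ t"
  proof (intro mult_left_mono power_mono)
    have "\<eta> * real (card X * card Y) \<le> real (\<Sum>y\<in>Y. card {x \<in> X. M x y})"
      using dense card_rel_sum[OF fin(1,2), of M] sum_card_swap[OF fin(1,2), of M] by simp
    then show "\<eta> * real (card X) \<le> (\<Sum>y\<in>Y. real (card {x \<in> X. M x y})) / real (card Y)"
      using y0 by (simp add: pos_le_divide_eq algebra_simps)
  qed (use assms in auto)
  also have "\<dots> \<le> (\<Sum>y\<in>Y. real (card {x \<in> X. M x y}) ^ t)"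
    by (rule power_mean) (use fin ne in auto)
  also have "\<dots> = real (\<Sum>y\<in>Y. card {p \<in> ?Xs. \<forall>u\<in>U. M (p u) y})"
  proof -
    have "card {p \<in> ?Xs. \<forall>u\<in>U. M (p u) y} = card {x \<in> X. M x y} ^ t" for y
    proof -
      have "{p \<in> ?Xs. \<forall>u\<in>U. M (p u) y} = U \<rightarrow>\<^sub>E {x \<in> X. M x y}"
        by (auto simp: PiE_iff extensional_def)
      then show ?thesis using fin by (simp add: card_PiE t_def)
    qed
    then show ?thesis by simp
  qed
  also have "\<dots> = (\<Sum>p\<in>?Xs. real (N p))"
    using sum_card_swap[OF finXs fin(2), of "\<lambda>p y. \<forall>u\<in>U. M (p u) y"]
    by (simp add: N_def flip: of_nat_sum)
  finally have S: "real (card Y) * (\<eta> * real (card X)) ^ t \<le> (\<Sum>p\<in>?Xs. real (N p))" .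
  have "\<eta> ^ (t * t) * real (card X * card Y) ^ t =
      real (card ?Xs) * (real (card Y) * (\<eta> * real (card X)) ^ t / real (card ?Xs)) ^ t"
    using x0 by (simp add: cXs power_mult_distrib power_mult[symmetric] power_divide)
  also have "\<dots> \<le> real (card ?Xs) * ((\<Sum>p\<in>?Xs. real (N p)) / real (card ?Xs)) ^ t"
    using S assms by (intro mult_left_mono power_mono divide_right_mono) auto
  also have "\<dots> \<le> (\<Sum>p\<in>?Xs. real (N p) ^ t)"
    by (rule power_mean) (use finXs neXs in auto)
  also have "\<dots> = real (\<Sum>p\<in>?Xs. card {r \<in> ?Ys. \<forall>u\<in>U. \<forall>u'\<in>U. M (p u) (r u')})"
  proof -
    have "card {r \<in> ?Ys. \<forall>u\<in>U. \<forall>u'\<in>U. M (p u) (r u')} = N p ^ t" for p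
    proof -
      have "{r \<in> ?Ys. \<forall>u\<in>U. \<forall>u'\<in>U. M (p u) (r u')} = U \<rightarrow>\<^sub>E {y \<in> Y. \<forall>u\<in>U. M (p u) y}"
        by (auto simp: PiE_iff extensional_def)
      then show ?thesis using fin by (simp add: card_PiE t_def N_def)
    qed
    then show ?thesis by simp
  qed
  also have "\<dots> = real (card {(p, r). p \<in> ?Xs \<and> r \<in> ?Ys \<and> (\<forall>u\<in>U. \<forall>u'\<in>U. M (p u) (r u'))})"
    using card_rel_sum[OF finXs finYs, of "\<lambda>p r. \<forall>u\<in>U. \<forall>u'\<in>U. M (p u) (r u')"] by simp
  also have "\<dots> \<le> real (card {q \<in> U \<rightarrow>\<^sub>E X \<times> Y. \<forall>u\<in>U. \<forall>u'\<in>U. M (fst (q u)) (snd (q u'))})"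
  proof (rule of_nat_mono, rule card_inj_on_le[where f = "\<lambda>(p, r). \<lambda>u\<in>U. (p u, r u)"])
    show "inj_on (\<lambda>(p, r). \<lambda>u\<in>U. (p u, r u))
        {(p, r). p \<in> ?Xs \<and> r \<in> ?Ys \<and> (\<forall>u\<in>U. \<forall>u'\<in>U. M (p u) (r u'))}"
    proof (rule inj_onI, clarsimp)
      fix p r p' r'
      assume h: "p \<in> ?Xs" "r \<in> ?Ys" "p' \<in> ?Xs" "r' \<in> ?Ys"
        and eq: "(\<lambda>u\<in>U. (p u, r u)) = (\<lambda>u\<in>U. (p' u, r' u))"
      have "p u = p' u \<and> r u = r' u" if "u \<in> U" for u
        using fun_cong[OF eq, of u] that by simp
      then show "p = p' \<and> r = r'" using h PiE_ext by metis
    qed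
  qed (use fin in \<open>auto intro!: finite_subset[OF _ finite_PiE[of U "\<lambda>_. X \<times> Y"]]\<close>)
  finally show ?thesis by (simp add: t_def)
qed

section \<open>Averages over the vertices and densities of walks\<close>

locale density_graph =
  fixes V :: "'v set" and A :: "'v \<Rightarrow> 'v \<Rightarrow> real" and \<alpha> :: real
  assumes fin: "finite V" and ne: "V \<noteq> {}"
    and A01: "A x y = 0 \<or> A x y = 1" and A_sym: "A x y = A y x"
    and \<alpha>_pos: "\<alpha> > 0"
    and deg_sum: "x \<in> V \<Longrightarrow> (1 / 4 + \<alpha>) * real (card V) \<le> (\<Sum>y\<in>V. A x y)"
begin

text \<open>Averages instead of sums keep the estimates free of powers of the number of vertices;
  restricting to a neighbourhood is multiplication by \<open>A\<close>.\<close>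

definition avg :: "('v \<Rightarrow> real) \<Rightarrow> real" where
  "avg f = (\<Sum>x\<in>V. f x) / real (card V)"

text \<open>\<open>D k x y\<close> is the density of the walks from \<open>x\<close> to \<open>y\<close> with \<open>k\<close> interior vertices.\<close>

primrec D :: "nat \<Rightarrow> 'v \<Rightarrow> 'v \<Rightarrow> real" where
  "D 0 x y = A x y"
| "D (Suc k) x y = avg (\<lambda>z. A x z * D k z y)"

definition codeg :: "'v \<Rightarrow> 'v \<Rightarrow> real" where
  "codeg x y = avg (\<lambda>z. A x z * A z y)"

lemma card_pos: "real (card V) > 0" using fin ne by (simp add: card_gt_0_iff)

lemma avg_const [simp]: "avg (\<lambda>_. c) = c" using card_pos by (simp add: avg_def)

lemma avg_add: "avg (\<lambda>x. f x + g x) = avg f + avg g"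
  by (simp add: avg_def sum.distrib add_divide_distrib)

lemma avg_diff: "avg (\<lambda>x. f x - g x) = avg f - avg g"
  by (simp add: avg_def sum_subtractf diff_divide_distrib)

lemma avg_mult_left: "avg (\<lambda>x. c * f x) = c * avg f"
  by (simp add: avg_def sum_distrib_left)

lemma avg_mult_right: "avg (\<lambda>x. f x * c) = avg f * c"
  by (simp add: avg_def sum_distrib_right)

lemma avg_mono: "(\<And>x. x \<in> V \<Longrightarrow> f x \<le> g x) \<Longrightarrow> avg f \<le> avg g"
  by (simp add: avg_def divide_right_mono sum_mono)

lemma avg_cong: "(\<And>x. x \<in> V \<Longrightarrow> f x = g x) \<Longrightarrow> avg f = avg g"
  by (simp add: avg_def)

lemma avg_nonneg: "(\<And>x. x \<in> V \<Longrightarrow> 0 \<le> f x) \<Longrightarrow> 0 \<le> avg f"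
  using avg_mono[of "\<lambda>_. 0" f] by simp

lemma avg_swap: "avg (\<lambda>x. avg (\<lambda>y. f x y)) = avg (\<lambda>y. avg (\<lambda>x. f x y))"
  using sum.swap[of f V V] by (simp add: avg_def sum_divide_distrib[symmetric])

lemma avg_square: "(avg f)\<^sup>2 \<le> avg (\<lambda>x. (f x)\<^sup>2)"
proof -
  have "0 \<le> avg (\<lambda>x. (f x - avg f)\<^sup>2)" by (rule avg_nonneg) simp
  also have "\<dots> = avg (\<lambda>x. (f x)\<^sup>2) - 2 * avg f * avg f + (avg f)\<^sup>2"
    by (simp add: power2_diff avg_add avg_diff avg_mult_left avg_mult_right
        mult.assoc mult.left_commute)
  finally show ?thesis by (simp add: power2_eq_square)
qed

lemma A_nonneg [simp]: "0 \<le> A x y" and A_le_1 [simp]: "A x y \<le> 1"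
  using A01[of x y] by auto

lemma deg: "x \<in> V \<Longrightarrow> 1 / 4 + \<alpha> \<le> avg (A x)"
  using deg_sum[of x] card_pos by (simp add: avg_def pos_le_divide_eq)

lemma deg': "x \<in> V \<Longrightarrow> 1 / 4 \<le> avg (A x)"
  using deg[of x] \<alpha>_pos by simp

lemma \<alpha>_le_1: "\<alpha> \<le> 1"
proof -
  obtain x where "x \<in> V" using ne by auto
  moreover have "avg (A x) \<le> 1" using avg_mono[of "A x" "\<lambda>_. 1"] by simp
  ultimately show ?thesis using deg[of x] by simp
qed

lemma D_nonneg [simp]: "0 \<le> D k x y"
  by (induction k arbitrary: x) (auto intro!: avg_nonneg)

lemma D_le_1 [simp]: "D k x y \<le> 1"
proof (induction k arbitrary: x)
  case (Suc k)
  have "avg (\<lambda>z. A x z * D k z y) \<le> avg (\<lambda>_. 1)"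
    by (rule avg_mono) (simp add: Suc mult_le_one)
  then show ?case by simp
qed simp

lemma D_add: "D (Suc (j + k)) x y = avg (\<lambda>z. D j x z * D k z y)"
proof (induction j arbitrary: x)
  case (Suc j)
  have "D (Suc (Suc j + k)) x y = avg (\<lambda>w. avg (\<lambda>z. A x w * D j w z * D k z y))"
    by (simp add: Suc[simplified] avg_mult_left[symmetric] mult.assoc)
  also have "\<dots> = avg (\<lambda>z. avg (\<lambda>w. A x w * D j w z * D k z y))" by (rule avg_swap)
  finally show ?case by (simp add: avg_mult_right)
qed simp

lemma D_sym: "D k x y = D k y x"
proof (induction k arbitrary: x y)
  case (Suc k)
  have "D (Suc k) x y = avg (\<lambda>z. D k y z * A z x)"
    by (simp add: Suc[of _ y] A_sym[of x] mult.commute)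
  also have "\<dots> = D (Suc k) y x" using D_add[of k 0 y x] by simp
  finally show ?case .
qed (simp add: A_sym)

lemma D_Suc_right: "D (Suc k) x y = avg (\<lambda>z. D k x z * A z y)"
  using D_add[of k 0 x y] by simp

lemma D_Suc_Suc: "D (Suc (Suc k)) x y = avg (\<lambda>p. avg (\<lambda>q. A x p * D k p q * A q y))"
  by (subst D.simps) (simp add: D_Suc_right avg_mult_left[symmetric] mult.assoc del: D.simps)

declare D.simps [simp del]

lemma D_1: "D (Suc 0) = codeg"
  by (intro ext) (simp add: D.simps codeg_def)

lemma codeg_sym: "codeg x y = codeg y x"
  using D_sym[of "Suc 0"] by (simp add: D_1)

lemma codeg_nonneg [simp]: "0 \<le> codeg x y" and codeg_le_1 [simp]: "codeg x y \<le> 1"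
  using D_nonneg[of "Suc 0"] D_le_1[of "Suc 0"] by (simp_all add: D_1)

text \<open>As for \<open>D\<close>, the index counts interior vertices: \<open>closed_walks k\<close> concerns length \<open>k + 1\<close>.\<close>

definition closed_walks :: "nat \<Rightarrow> real" where
  "closed_walks k = avg (\<lambda>x. D k x x)"

lemma closed_walks_2: "avg (\<lambda>x. avg (\<lambda>y. A x y * codeg x y)) = closed_walks 2"
  by (simp add: closed_walks_def numeral_2_eq_2 D.simps(2)[of "Suc 0"] D_1 codeg_sym[of y for y])

lemma D2_eq: "avg (\<lambda>p. avg (\<lambda>q. A x p * A p q * A q y)) = D 2 x y"
  using D_Suc_Suc[of 0 x y] by (simp add: numeral_2_eq_2 D.simps(1))

lemma D2_left: "avg (\<lambda>p. A x p * codeg p y) = D 2 x y"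
  by (simp add: numeral_2_eq_2 D.simps(2)[of "Suc 0"] D_1)

lemma D3_eq: "avg (\<lambda>p. avg (\<lambda>q. A x p * codeg p q * A q y)) = D 3 x y"
  using D_Suc_Suc[of "Suc 0" x y] by (simp add: numeral_3_eq_3 D_1)

lemma D3_left: "avg (\<lambda>p. avg (\<lambda>q. A x p * A p q * codeg q y)) = D 3 x y"
  by (simp add: numeral_3_eq_3 D.simps(2) D_1 avg_mult_left mult.assoc codeg_def)

lemma D3_left': "avg (\<lambda>q. avg (\<lambda>p. A x p * A p q * codeg q y)) = D 3 x y"
  by (subst avg_swap) (rule D3_left)

text \<open>Bonferroni's inequality for four neighbourhoods of density at least \<open>1/4 + \<alpha>\<close>.\<close>

lemma four_vertices:
  assumes "a \<in> V" "b \<in> V" "c \<in> V" "d \<in> V"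
  shows "4 * \<alpha> \<le> codeg a b + codeg a c + codeg a d + codeg b c + codeg b d + codeg c d"
proof -
  have "4 * \<alpha> \<le> avg (A a) + avg (A b) + avg (A c) + avg (A d) - 1"
    using assms deg[of a] deg[of b] deg[of c] deg[of d] by simp
  also have "\<dots> = avg (\<lambda>z. A a z + A b z + A c z + A d z - 1)"
    by (simp add: avg_add avg_diff)
  also have "\<dots> \<le> avg (\<lambda>z. A a z * A z b + A a z * A z c + A a z * A z d
       + A b z * A z c + A b z * A z d + A c z * A z d)"
  proof (rule avg_mono)
    fix z
    show "A a z + A b z + A c z + A d z - 1 \<le> A a z * A z b + A a z * A z c + A a z * A z d
       + A b z * A z c + A b z * A z d + A c z * A z d"
      using A01[of a z] A01[of b z] A01[of c z] A01[of d z]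
      unfolding A_sym[of z] by (elim disjE) simp_all
  qed
  finally show ?thesis by (simp add: avg_add codeg_def)
qed

text \<open>Each common neighbour of \<open>x\<close> and \<open>y\<close> has degree density at
  least 1/4. Cauchy-Schwarz over the other end \<open>z\<close> of these edges yields many walks
  \<open>p\<close>, \<open>z\<close>, \<open>q\<close> whose ends are common neighbours, and
  \<open>x\<close>, \<open>p\<close>, \<open>z\<close>, \<open>q\<close>, \<open>y\<close> is then a
  walk of length 4. For an edge this means that few 5-cycles through it force few triangles through
  it.\<close>

lemma codeg_square: assumes "x \<in> V" "y \<in> V" shows "(codeg x y)\<^sup>2 / 16 \<le> D 3 x y"
proof -
  define t where "t z = A x z * A z y" for z
  have t: "0 \<le> t z" "t z \<le> A x z" "t z \<le> A z y" for z
    using A01[of x z] A01[of z y] by (auto simp: t_def)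
  have d: "codeg x y = avg t" by (simp add: t_def[abs_def] codeg_def)
  have "avg t / 4 = avg (\<lambda>p. t p * (1 / 4))" by (subst avg_mult_right) simp
  also have "\<dots> \<le> avg (\<lambda>p. t p * avg (A p))"
    by (intro avg_mono mult_left_mono deg') (auto simp: t)
  also have "\<dots> = avg (\<lambda>p. avg (\<lambda>z. t p * A p z))" by (simp add: avg_mult_left)
  also have "\<dots> = avg (\<lambda>z. avg (\<lambda>p. t p * A p z))" by (rule avg_swap)
  finally have "(avg t / 4)\<^sup>2 \<le> (avg (\<lambda>z. avg (\<lambda>p. t p * A p z)))\<^sup>2"
    by (rule power_mono) (auto intro!: avg_nonneg divide_nonneg_nonneg t)
  also have "\<dots> \<le> avg (\<lambda>z. (avg (\<lambda>p. t p * A p z))\<^sup>2)" by (rule avg_square)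
  also have "\<dots> = avg (\<lambda>z. avg (\<lambda>p. avg (\<lambda>q. t p * A p z * A z q * t q)))"
    by (simp add: power2_eq_square avg_mult_left[symmetric] avg_mult_right[symmetric]
        A_sym[of z for z] mult_ac)
  also have "\<dots> = avg (\<lambda>p. avg (\<lambda>q. avg (\<lambda>z. t p * A p z * A z q * t q)))"
    by (subst avg_swap) (rule avg_cong, rule avg_swap)
  also have "\<dots> = avg (\<lambda>p. avg (\<lambda>q. t p * codeg p q * t q))"
    by (simp add: codeg_def avg_mult_left[symmetric] avg_mult_right[symmetric] mult.assoc)
  also have "\<dots> \<le> avg (\<lambda>p. avg (\<lambda>q. A x p * codeg p q * A q y))"
    by (intro avg_mono mult_mono) (auto simp: t)
  also have "\<dots> = D 3 x y"
    by (rule D3_eq)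
  finally show ?thesis by (simp add: d power_divide)
qed

end

section \<open>Pentagons\<close>

context density_graph begin

lemma quad_avg:
  assumes "\<And>a b c d. a \<in> V \<Longrightarrow> b \<in> V \<Longrightarrow> c \<in> V \<Longrightarrow> d \<in> V \<Longrightarrow> f a b c d \<le> g a b c d"
  shows "avg (\<lambda>a. avg (\<lambda>b. avg (\<lambda>c. avg (\<lambda>d. f a b c d))))
    \<le> avg (\<lambda>a. avg (\<lambda>b. avg (\<lambda>c. avg (\<lambda>d. g a b c d))))"
  using assms by (intro avg_mono) auto

lemma triple_avg:
  assumes "\<And>a b c. a \<in> V \<Longrightarrow> b \<in> V \<Longrightarrow> c \<in> V \<Longrightarrow> f a b c \<le> g a b c"
  shows "avg (\<lambda>a. avg (\<lambda>b. avg (\<lambda>c. f a b c)))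
    \<le> avg (\<lambda>a. avg (\<lambda>b. avg (\<lambda>c. g a b c)))"
  using assms by (intro avg_mono) auto

text \<open>Apply \<open>four_vertices\<close> to \<open>a\<close>, \<open>b\<close>,
  \<open>c\<close>, \<open>d\<close> for triangles \<open>v a b\<close> and \<open>w c d\<close>.
  The pairs \<open>ab\<close> and \<open>cd\<close> are edges, so a common neighbour gives a
  triangle; each of the four mixed pairs gives a walk such as \<open>v\<close>, \<open>a\<close>,
  \<open>z\<close>, \<open>c\<close>, \<open>w\<close>.\<close>

lemma triangle_product_le:
  assumes "v \<in> V" "w \<in> V"
  shows "4 * \<alpha> * (D 2 v v * D 2 w w) \<le> 2 * closed_walks 2 + 4 * D 3 v w"
proof -
  define T where "T v z u = A v z * A z u * A u v" for v z u
  have T1: "T v z u = 0 \<or> A v z = 1 \<and> A z u = 1 \<and> A u v = 1" for v z u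
    using A01[of v z] A01[of z u] A01[of u v] by (auto simp: T_def)
  have "4 * \<alpha> * (D 2 v v * D 2 w w) =
      avg (\<lambda>a. avg (\<lambda>b. avg (\<lambda>c. avg (\<lambda>d. 4 * \<alpha> * (T v a b * T w c d)))))"
    by (simp add: D2_eq[symmetric] T_def[symmetric] avg_mult_left avg_mult_right)
  also have "\<dots> \<le> avg (\<lambda>a. avg (\<lambda>b. avg (\<lambda>c. avg (\<lambda>d. A a b * codeg a b + A c d * codeg c d
      + A v a * codeg a c * A c w + A v a * codeg a d * A d w
      + A v b * codeg b c * A c w + A v b * codeg b d * A d w))))"
  proof (rule quad_avg)
    fix a b c d assume V: "a \<in> V" "b \<in> V" "c \<in> V" "d \<in> V"
    show "4 * \<alpha> * (T v a b * T w c d) \<le> A a b * codeg a b + A c d * codeg c d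
      + A v a * codeg a c * A c w + A v a * codeg a d * A d w
      + A v b * codeg b c * A c w + A v b * codeg b d * A d w"
    proof (cases "T v a b = 0 \<or> T w c d = 0")
      case True then show ?thesis by (auto intro!: add_nonneg_nonneg)
    next
      case False
      then have h: "A v a = 1" "A a b = 1" "A b v = 1" "A v b = 1"
        "A w c = 1" "A c d = 1" "A d w = 1" "A c w = 1"
        using T1[of v a b] T1[of w c d] A_sym[of v b] A_sym[of w c] by auto
      then show ?thesis using four_vertices[OF V] by (simp add: T_def)
    qed
  qed
  also have "\<dots> = 2 * closed_walks 2 + 4 * D 3 v w"
    by (simp add: avg_add closed_walks_2 D3_eq avg_mult_left)
  finally show ?thesis .
qed

text \<open>Here the triangle at \<open>w\<close> is replaced by \<open>w\<close> itself and a
  neighbour \<open>c\<close>. The pairs \<open>aw\<close> and \<open>bw\<close> still give walks of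
  length 4 from \<open>v\<close> when the triangle is traversed the long way, as in
  \<open>v\<close>, \<open>b\<close>, \<open>a\<close>, \<open>z\<close>, \<open>w\<close>. The pair
  \<open>cw\<close> closes a triangle at \<open>w\<close> and leaves the product that
  \<open>triangle_product_le\<close> controls.\<close>

lemma triangle_le:
  assumes "v \<in> V" "w \<in> V"
  shows "\<alpha> * D 2 v v \<le> closed_walks 2 + 4 * D 3 v w + D 2 v v * D 2 w w"
proof -
  define T where "T z u = A v z * A z u * A u v" for z u
  have T1: "T z u = 0 \<or> A v z = 1 \<and> A z u = 1 \<and> A u v = 1" for z u
    using A01[of v z] A01[of z u] A01[of u v] by (auto simp: T_def)
  have "4 * \<alpha> * D 2 v v * (1 / 4) \<le> 4 * \<alpha> * D 2 v v * avg (A w)"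
    using \<alpha>_pos assms by (intro mult_left_mono deg') auto
  also have "\<dots> = avg (\<lambda>a. avg (\<lambda>b. avg (\<lambda>c. 4 * \<alpha> * T a b * A w c)))"
    by (simp add: D2_eq[symmetric] T_def[symmetric] avg_mult_left avg_mult_right)
  also have "\<dots> \<le> avg (\<lambda>a. avg (\<lambda>b. avg (\<lambda>c. A a b * codeg a b
      + A v a * codeg a c * A c w + A v b * codeg b c * A c w
      + A v b * A b a * codeg a w + A v a * A a b * codeg b w
      + T a b * (A w c * codeg c w))))"
  proof (rule triple_avg)
    fix a b c assume V: "a \<in> V" "b \<in> V" "c \<in> V"
    show "4 * \<alpha> * T a b * A w c \<le> A a b * codeg a b
      + A v a * codeg a c * A c w + A v b * codeg b c * A c w
      + A v b * A b a * codeg a w + A v a * A a b * codeg b w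
      + T a b * (A w c * codeg c w)"
    proof (cases "T a b = 0 \<or> A w c = 0")
      case True then show ?thesis by (auto intro!: add_nonneg_nonneg)
    next
      case False
      then have h: "A v a = 1" "A a b = 1" "A b v = 1" "A v b = 1" "A b a = 1"
        "A w c = 1" "A c w = 1"
        using T1[of a b] A01[of w c] A_sym[of v b] A_sym[of a b] A_sym[of w c] by auto
      then show ?thesis using four_vertices[OF V assms(2)] by (simp add: T_def)
    qed
  qed
  also have "\<dots> = closed_walks 2 + 4 * D 3 v w + D 2 v v * D 2 w w"
  proof -
    have "avg (\<lambda>a. avg (\<lambda>b. avg (\<lambda>c. T a b * (A w c * codeg c w)))) = D 2 v v * D 2 w w"
      by (simp add: avg_mult_left avg_mult_right D2_left) (simp add: T_def[abs_def] D2_eq)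
    then show ?thesis by (simp add: avg_add closed_walks_2 D3_eq D3_left D3_left')
  qed
  finally show ?thesis by simp
qed

lemma triangle_small:
  assumes "v \<in> V" "w \<in> V" "D 3 v w \<le> \<xi>" "closed_walks 2 \<le> 2 * \<xi>"
  shows "D 2 v v \<le> 8 * \<xi> / \<alpha>\<^sup>2"
proof -
  have xi: "\<xi> \<ge> 0" using assms(3) D_nonneg[of 3 v w] by linarith
  have p: "D 2 v v * D 2 w w \<le> 2 * \<xi> / \<alpha>"
    using triangle_product_le[OF assms(1,2)] assms \<alpha>_pos by (simp add: pos_le_divide_eq mult_ac)
  have "\<alpha> * D 2 v v \<le> 6 * \<xi> + 2 * \<xi> / \<alpha>"
    using triangle_le[OF assms(1,2)] assms p by linarith
  also have "6 * \<xi> \<le> 6 * \<xi> / \<alpha>"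
    using xi \<alpha>_pos \<alpha>_le_1 by (simp add: pos_le_divide_eq mult_left_le)
  finally show ?thesis using \<alpha>_pos by (simp add: field_simps power2_eq_square)
qed

text \<open>The average on the left counts adjacent \<open>z\<close>, \<open>s\<close> with
  \<open>z\<close> a common neighbour of \<open>v0\<close>, \<open>v2\<close> and \<open>s\<close> a
  neighbour of \<open>v3\<close>. Add a common neighbour \<open>w\<close> of \<open>v1\<close>,
  \<open>v4\<close> and use \<open>four_vertices\<close> on \<open>z\<close>, \<open>s\<close>,
  \<open>w\<close>, \<open>v4\<close>: \<open>zs\<close> gives triangles, \<open>zw\<close> walks
  from \<open>v0\<close> to \<open>v1\<close>, \<open>sw\<close> and (through \<open>s\<close>)
  \<open>z v4\<close> walks from \<open>v3\<close> to \<open>v4\<close>, \<open>s v4\<close>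
  (through \<open>z\<close>) walks from \<open>v0\<close> to \<open>v4\<close>, and
  \<open>w v4\<close> triangles at \<open>v4\<close>.\<close>

lemma cross_edges_le:
  assumes V: "v0 \<in> V" "v1 \<in> V" "v2 \<in> V" "v3 \<in> V" "v4 \<in> V"
    and common: "\<alpha> \<le> codeg v1 v4"
  shows "4 * \<alpha>\<^sup>2 * avg (\<lambda>z. A v0 z * A z v2 * codeg z v3)
    \<le> closed_walks 2 + D 3 v0 v1 + 2 * D 3 v3 v4 + D 3 v0 v4 + D 2 v4 v4"
proof -
  define T where "T z s = A v0 z * A z v2 * A z s * A s v3" for z s
  define S where "S w = A v1 w * A w v4" for w
  have T1: "T z s = 0 \<or> A v0 z = 1 \<and> A z v2 = 1 \<and> A z s = 1 \<and> A s v3 = 1" for z s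
    using A01[of v0 z] A01[of z v2] A01[of z s] A01[of s v3] by (auto simp: T_def)
  have S1: "S w = 0 \<or> A v1 w = 1 \<and> A w v4 = 1" for w
    using A01[of v1 w] A01[of w v4] by (auto simp: S_def)
  have e: "avg (\<lambda>z. A v0 z * A z v2 * codeg z v3) = avg (\<lambda>z. avg (\<lambda>s. T z s))"
    by (simp add: T_def codeg_def avg_mult_left mult.assoc)
  have e0: "0 \<le> avg (\<lambda>z. avg (\<lambda>s. T z s))"
    by (intro avg_nonneg) (simp add: T_def)
  have "4 * \<alpha> * avg (\<lambda>z. avg (\<lambda>s. T z s)) * \<alpha> \<le> 4 * \<alpha> * avg (\<lambda>z. avg (\<lambda>s. T z s)) * avg S"
    using \<alpha>_pos e0 common by (intro mult_left_mono) (auto simp: S_def[abs_def] codeg_def)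
  also have "\<dots> = avg (\<lambda>z. avg (\<lambda>s. avg (\<lambda>w. 4 * \<alpha> * T z s * S w)))"
    by (simp add: avg_mult_left avg_mult_right)
  also have "\<dots> \<le> avg (\<lambda>z. avg (\<lambda>s. avg (\<lambda>w. A z s * codeg z s
      + A v0 z * codeg z w * A w v1 + A v3 s * A s z * codeg z v4
      + A v3 s * codeg s w * A w v4 + A v0 z * A z s * codeg s v4
      + A v4 w * codeg w v4)))"
  proof (rule triple_avg)
    fix z s w assume W: "z \<in> V" "s \<in> V" "w \<in> V"
    show "4 * \<alpha> * T z s * S w \<le> A z s * codeg z s
      + A v0 z * codeg z w * A w v1 + A v3 s * A s z * codeg z v4
      + A v3 s * codeg s w * A w v4 + A v0 z * A z s * codeg s v4
      + A v4 w * codeg w v4"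
    proof (cases "T z s = 0 \<or> S w = 0")
      case True then show ?thesis by (auto intro!: add_nonneg_nonneg)
    next
      case False
      then have h: "A v0 z = 1" "A z v2 = 1" "A z s = 1" "A s z = 1" "A s v3 = 1" "A v3 s = 1"
        "A v1 w = 1" "A w v1 = 1" "A w v4 = 1" "A v4 w = 1"
        using T1[of z s] S1[of w] A_sym[of z s] A_sym[of s v3] A_sym[of v1 w] A_sym[of w v4]
        by auto
      then show ?thesis using four_vertices[OF W V(5)] by (simp add: T_def S_def)
    qed
  qed
  also have "\<dots> = closed_walks 2 + D 3 v0 v1 + 2 * D 3 v3 v4 + D 3 v0 v4 + D 2 v4 v4"
    by (simp add: avg_add closed_walks_2 D3_eq D3_left D3_left' D2_left)
  finally show ?thesis unfolding e by (simp add: power2_eq_square mult_ac)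
qed

text \<open>The same device for \<open>z\<close>, \<open>w\<close> as before, an arbitrary neighbour
  \<open>s\<close> of \<open>v3\<close>, and \<open>v3\<close>. The pairs \<open>zw\<close>,
  \<open>zs\<close>, \<open>ws\<close> give walks along three sides of the pentagon and
  \<open>s v3\<close> gives triangles; \<open>z v3\<close> and \<open>w v3\<close> give the two
  averages that \<open>cross_edges_le\<close> bounds.\<close>

lemma split_edges_le:
  assumes V: "v0 \<in> V" "v1 \<in> V" "v2 \<in> V" "v3 \<in> V" "v4 \<in> V"
    and common: "\<alpha> \<le> codeg v0 v2" "\<alpha> \<le> codeg v1 v4"
  shows "\<alpha> ^ 3 \<le> D 3 v0 v1 + D 3 v2 v3 + D 3 v4 v3 + D 2 v3 v3
    + avg (\<lambda>z. A v0 z * A z v2 * codeg z v3) + avg (\<lambda>w. A v1 w * A w v4 * codeg w v3)"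
proof -
  define S where "S x y w = A x w * A w y" for x y w
  have S1: "S x y w = 0 \<or> A x w = 1 \<and> A w y = 1" for x y w
    using A01[of x w] A01[of w y] by (auto simp: S_def)
  have "\<alpha> ^ 3 = 4 * \<alpha> * (\<alpha> * \<alpha> * (1 / 4))" by (simp add: power3_eq_cube)
  also have "\<dots> \<le> 4 * \<alpha> * (avg (S v0 v2) * avg (S v1 v4) * avg (A v3))"
    using \<alpha>_pos common V by (intro mult_left_mono mult_mono deg')
      (auto simp: S_def[abs_def] codeg_def[symmetric])
  also have "\<dots> = avg (\<lambda>z. avg (\<lambda>w. avg (\<lambda>s. 4 * \<alpha> * (S v0 v2 z * S v1 v4 w * A v3 s))))"
    by (simp add: avg_mult_left avg_mult_right)
  also have "\<dots> \<le> avg (\<lambda>z. avg (\<lambda>w. avg (\<lambda>s. A v0 z * codeg z w * A w v1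
      + A v2 z * codeg z s * A s v3 + A v4 w * codeg w s * A s v3
      + A v3 s * codeg s v3 + A v0 z * A z v2 * codeg z v3 + A v1 w * A w v4 * codeg w v3)))"
  proof (rule triple_avg)
    fix z w s assume W: "z \<in> V" "w \<in> V" "s \<in> V"
    show "4 * \<alpha> * (S v0 v2 z * S v1 v4 w * A v3 s) \<le> A v0 z * codeg z w * A w v1
      + A v2 z * codeg z s * A s v3 + A v4 w * codeg w s * A s v3
      + A v3 s * codeg s v3 + A v0 z * A z v2 * codeg z v3 + A v1 w * A w v4 * codeg w v3"
    proof (cases "S v0 v2 z = 0 \<or> S v1 v4 w = 0 \<or> A v3 s = 0")
      case True then show ?thesis by (auto intro!: add_nonneg_nonneg)
    next
      case False
      then have h: "A v0 z = 1" "A z v2 = 1" "A v2 z = 1" "A s v3 = 1" "A v3 s = 1"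
        "A v1 w = 1" "A w v1 = 1" "A w v4 = 1" "A v4 w = 1"
        using S1[of v0 v2 z] S1[of v1 v4 w] A01[of v3 s]
          A_sym[of z v2] A_sym[of s v3] A_sym[of v1 w] A_sym[of w v4]
        by auto
      then show ?thesis using four_vertices[OF W V(4)] by (simp add: S_def)
    qed
  qed
  also have "\<dots> = D 3 v0 v1 + D 3 v2 v3 + D 3 v4 v3 + D 2 v3 v3
    + avg (\<lambda>z. A v0 z * A z v2 * codeg z v3) + avg (\<lambda>w. A v1 w * A w v4 * codeg w v3)"
    by (simp add: avg_add D3_eq D2_left)
  finally show ?thesis .
qed

text \<open>
  The common neighbourhoods of \<open>v0, v2\<close> and of \<open>v1, v4\<close> and the neighbourhood of \<open>v3\<close> contain only
  few pairs with many common neighbours. Hence \<open>v3\<close> must share many neighbours with one of the two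
  common neighbourhoods, which is impossible by the same argument with \<open>v4\<close> or \<open>v2\<close> as fourth vertex.
\<close>

lemma pentagon_two_pairs:
  assumes V: "v0 \<in> V" "v1 \<in> V" "v2 \<in> V" "v3 \<in> V" "v4 \<in> V"
    and "D 3 v0 v1 \<le> \<xi>" "D 3 v1 v2 \<le> \<xi>" "D 3 v2 v3 \<le> \<xi>" "D 3 v3 v4 \<le> \<xi>" "D 3 v4 v0 \<le> \<xi>"
    and "closed_walks 2 \<le> 2 * \<xi>" and common: "\<alpha> \<le> codeg v0 v2" "\<alpha> \<le> codeg v1 v4"
  shows "\<alpha> ^ 7 \<le> 19 * \<xi>"
proof -
  have xi: "\<xi> \<ge> 0" using assms(6) D_nonneg[of 3 v0 v1] by linarith
  have sym: "D 3 v1 v0 = D 3 v0 v1" "D 3 v3 v2 = D 3 v2 v3" "D 3 v4 v3 = D 3 v3 v4"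
    "D 3 v0 v4 = D 3 v4 v0" by (rule D_sym)+
  define X where "X = 8 * \<xi> / \<alpha>\<^sup>2"
  have t: "D 2 v3 v3 \<le> X" "D 2 v4 v4 \<le> X" "D 2 v2 v2 \<le> X"
    unfolding X_def using assms by (auto intro: triangle_small)
  define eZ where "eZ = avg (\<lambda>z. A v0 z * A z v2 * codeg z v3)"
  define eW where "eW = avg (\<lambda>z. A v1 z * A z v4 * codeg z v3)"
  have z: "4 * \<alpha>\<^sup>2 * eZ \<le> 6 * \<xi> + X"
    using cross_edges_le[OF V common(2)] assms t sym unfolding eZ_def by linarith
  have w: "4 * \<alpha>\<^sup>2 * eW \<le> 6 * \<xi> + X"
    \<comment> \<open>The reflection of the pentagon that fixes \<open>v3\<close> exchanges the two
      pairs in \<open>common\<close>.\<close>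
    using cross_edges_le[of v1 v0 v4 v3 v2] V common(1) assms t sym unfolding eW_def by linarith
  have s: "\<alpha> ^ 3 \<le> 3 * \<xi> + X + eZ + eW"
    using split_edges_le[OF V common] assms t sym unfolding eZ_def eW_def by linarith
  have a2: "\<alpha>\<^sup>2 \<le> 1" and a20: "0 \<le> \<alpha>\<^sup>2" using \<alpha>_pos \<alpha>_le_1 by (auto simp: power_le_one)
  have Xa: "\<alpha>\<^sup>2 * X = 8 * \<xi>" using \<alpha>_pos by (simp add: X_def)
  \<comment> \<open>Both \<open>X\<close> and the bounds on \<open>eZ\<close>, \<open>eW\<close>
    divide by the square of \<open>\<alpha>\<close>, and the latter also contain \<open>X\<close>;
    the factor \<open>\<alpha>\<close> to the fourth clears all denominators and turns the exponent
    3 into 7.\<close>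
  have "4 * \<alpha> ^ 7 = 4 * (\<alpha>\<^sup>2 * \<alpha>\<^sup>2) * \<alpha> ^ 3" by (simp flip: power_add)
  also have "\<dots> \<le> 4 * (\<alpha>\<^sup>2 * \<alpha>\<^sup>2) * (3 * \<xi> + X + eZ + eW)"
    using s by (intro mult_left_mono) auto
  also have "\<dots> = 12 * (\<alpha>\<^sup>2 * (\<alpha>\<^sup>2 * \<xi>)) + 4 * (\<alpha>\<^sup>2 * (\<alpha>\<^sup>2 * X)) + \<alpha>\<^sup>2 * (4 * \<alpha>\<^sup>2 * eZ)
      + \<alpha>\<^sup>2 * (4 * \<alpha>\<^sup>2 * eW)" by (simp add: algebra_simps)
  also have "\<dots> \<le> 12 * (\<alpha>\<^sup>2 * (\<alpha>\<^sup>2 * \<xi>)) + 4 * (\<alpha>\<^sup>2 * (8 * \<xi>)) + \<alpha>\<^sup>2 * (6 * \<xi> + X)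
      + \<alpha>\<^sup>2 * (6 * \<xi> + X)"
    using z w a20 unfolding Xa by (intro add_mono mult_left_mono) auto
  also have "\<dots> = 12 * (\<alpha>\<^sup>2 * (\<alpha>\<^sup>2 * \<xi>)) + 44 * (\<alpha>\<^sup>2 * \<xi>) + 16 * \<xi>"
    using Xa by (simp add: algebra_simps)
  also have "\<dots> \<le> 12 * \<xi> + 44 * \<xi> + 16 * \<xi>"
  proof -
    have "\<alpha>\<^sup>2 * \<xi> \<le> \<xi>" using a2 xi by (simp add: mult_left_le_one_le)
    moreover have "\<alpha>\<^sup>2 * (\<alpha>\<^sup>2 * \<xi>) \<le> \<alpha>\<^sup>2 * \<xi>" using a2 xi by (intro mult_left_le_one_le) auto
    ultimately show ?thesis by linarith
  qed
  finally show ?thesis using xi by linarith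
qed

text \<open>Call a diagonal heavy if its codegree is at least \<open>\<alpha>\<close>. By
  \<open>pentagon_two_pairs\<close> any two heavy diagonals share an endpoint. The diagonals form a
  5-cycle themselves, so all heavy ones pass through one vertex. Among the other four vertices the
  three sides contribute at most \<open>3 * \<xi>\<close>, which is less than
  \<open>\<alpha>\<close>, so \<open>four_vertices\<close> makes one of the three diagonals there
  heavy, a contradiction.\<close>

lemma pentagon_dense_edge:
  assumes V: "v0 \<in> V" "v1 \<in> V" "v2 \<in> V" "v3 \<in> V" "v4 \<in> V"
    and d: "D 3 v0 v1 \<le> \<xi>" "D 3 v1 v2 \<le> \<xi>" "D 3 v2 v3 \<le> \<xi>" "D 3 v3 v4 \<le> \<xi>" "D 3 v4 v0 \<le> \<xi>"
    and c: "codeg v0 v1 \<le> \<xi>" "codeg v1 v2 \<le> \<xi>" "codeg v2 v3 \<le> \<xi>" "codeg v3 v4 \<le> \<xi>" "codeg v4 v0 \<le> \<xi>"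
    and "closed_walks 2 \<le> 2 * \<xi>"
  shows "\<alpha> ^ 7 \<le> 19 * \<xi>"
proof (rule ccontr)
  assume neg: "\<not> \<alpha> ^ 7 \<le> 19 * \<xi>"
  have "\<alpha> ^ 7 \<le> \<alpha> ^ 1" by (rule power_decreasing) (use \<alpha>_pos \<alpha>_le_1 in auto)
  then have xi: "3 * \<xi> < \<alpha>" using neg \<alpha>_pos by simp
  have cs: "codeg v1 v0 \<le> \<xi>" "codeg v2 v1 \<le> \<xi>" "codeg v3 v2 \<le> \<xi>" "codeg v4 v3 \<le> \<xi>"
    "codeg v0 v4 \<le> \<xi>" using c by (simp_all add: codeg_sym)
  have no: "\<not> (\<alpha> \<le> codeg v0 v2 \<and> \<alpha> \<le> codeg v1 v4)" "\<not> (\<alpha> \<le> codeg v1 v3 \<and> \<alpha> \<le> codeg v2 v0)"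
    "\<not> (\<alpha> \<le> codeg v2 v4 \<and> \<alpha> \<le> codeg v3 v1)" "\<not> (\<alpha> \<le> codeg v3 v0 \<and> \<alpha> \<le> codeg v4 v2)"
    "\<not> (\<alpha> \<le> codeg v4 v1 \<and> \<alpha> \<le> codeg v0 v3)"
    using pentagon_two_pairs[of v0 v1 v2 v3 v4 \<xi>] pentagon_two_pairs[of v1 v2 v3 v4 v0 \<xi>]
      pentagon_two_pairs[of v2 v3 v4 v0 v1 \<xi>] pentagon_two_pairs[of v3 v4 v0 v1 v2 \<xi>]
      pentagon_two_pairs[of v4 v0 v1 v2 v3 \<xi>] neg assms by blast+
  have "\<alpha> \<le> codeg v0 v2 \<or> \<alpha> \<le> codeg v0 v3 \<or> \<alpha> \<le> codeg v1 v3"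
    using four_vertices[of v0 v1 v2 v3] V c xi by fastforce
  moreover have "\<alpha> \<le> codeg v1 v3 \<or> \<alpha> \<le> codeg v1 v4 \<or> \<alpha> \<le> codeg v2 v4"
    using four_vertices[of v1 v2 v3 v4] V c xi by fastforce
  moreover have "\<alpha> \<le> codeg v0 v2 \<or> \<alpha> \<le> codeg v0 v3 \<or> \<alpha> \<le> codeg v2 v4"
    using four_vertices[of v0 v2 v3 v4] V c cs xi by fastforce
  moreover have "\<alpha> \<le> codeg v0 v3 \<or> \<alpha> \<le> codeg v1 v3 \<or> \<alpha> \<le> codeg v1 v4"
    using four_vertices[of v0 v1 v3 v4] V c cs xi by fastforce
  moreover have "\<alpha> \<le> codeg v0 v2 \<or> \<alpha> \<le> codeg v1 v4 \<or> \<alpha> \<le> codeg v2 v4"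
    using four_vertices[of v0 v1 v2 v4] V c cs xi by fastforce
  ultimately show False
    using no by (simp add: codeg_sym[of v2 v0] codeg_sym[of v3 v1] codeg_sym[of v4 v2]
      codeg_sym[of v3 v0] codeg_sym[of v4 v1]) blast
qed

end

section \<open>Odd closed walks\<close>

text \<open>Each new link multiplies by the constant \<open>8 / \<alpha>\<close> of
  \<open>link_err\<close>, and by 4 for averaging over a neighbourhood of density at least
  1/4.\<close>

primrec link_const :: "real \<Rightarrow> nat \<Rightarrow> real" where
  "link_const \<alpha> 0 = 8 / \<alpha>"
| "link_const \<alpha> (Suc k) = 4 * (link_const \<alpha> k * (8 / \<alpha>))"

primrec link_error :: "real \<Rightarrow> nat \<Rightarrow> real" where
  "link_error \<alpha> 0 = 24 / \<alpha>"
| "link_error \<alpha> (Suc k) = 4 * ((8 / \<alpha> + 1) * link_error \<alpha> k + link_const \<alpha> k * (24 / \<alpha>))"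

text \<open>The recursion solves \<open>closed_walks_step\<close>; index \<open>j\<close> belongs to
  closed walks of length \<open>7 + 2 * j\<close>.\<close>

primrec closed_walks_const :: "real \<Rightarrow> nat \<Rightarrow> real" where
  "closed_walks_const \<alpha> 0 = 2"
| "closed_walks_const \<alpha> (Suc j) = (8 + 2 * closed_walks_const \<alpha> j) / (4 * \<alpha>)"

definition odd_walk_const :: "real \<Rightarrow> nat \<Rightarrow> real" where
  "odd_walk_const \<alpha> l = link_const \<alpha> (2 * l + 1) * (8 / \<alpha>) * closed_walks_const \<alpha> (3 * l + 1)
     + (8 / \<alpha> + 1) * link_error \<alpha> (2 * l + 1) + link_const \<alpha> (2 * l + 1) * (24 / \<alpha>)"

lemma link_const_pos: "\<alpha> > 0 \<Longrightarrow> link_const \<alpha> k > 0" by (induction k) auto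

lemma link_error_pos: "\<alpha> > 0 \<Longrightarrow> link_error \<alpha> k > 0"
  by (induction k) (auto intro!: add_pos_pos mult_pos_pos divide_pos_pos link_const_pos)

lemma closed_walks_const_pos: "\<alpha> > 0 \<Longrightarrow> closed_walks_const \<alpha> k > 0"
  by (induction k) auto

lemma odd_walk_const_pos: "\<alpha> > 0 \<Longrightarrow> odd_walk_const \<alpha> l > 0"
  unfolding odd_walk_const_def by (intro add_pos_pos mult_pos_pos link_const_pos link_error_pos closed_walks_const_pos) auto

context density_graph begin

lemma closed_walks_add: "avg (\<lambda>x. avg (\<lambda>y. D a x y * D b y x)) = closed_walks (Suc (a + b))"
  by (simp add: closed_walks_def D_add)

lemma closed_walks_add3:
  "avg (\<lambda>x. avg (\<lambda>y. avg (\<lambda>z. D a x y * D b y z * D c z x))) = closed_walks (a + b + c + 2)"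
  using closed_walks_add[of a "Suc (b + c)"] by (simp add: D_add avg_mult_left[symmetric] mult.assoc add_ac)

lemma closed_walks_add4:
  "avg (\<lambda>x. avg (\<lambda>y. avg (\<lambda>z. avg (\<lambda>w. D a x y * D b y z * D c z w * D d w x))))
    = closed_walks (a + b + c + d + 3)"
  using closed_walks_add3[of a b "Suc (c + d)"]
  by (simp add: D_add avg_mult_left[symmetric] mult.assoc add_ac numeral_3_eq_3)

text \<open>
  Apply \<open>four_vertices\<close> to the first, second, fifth and sixth vertex of a closed walk: two of them have many
  common neighbours, and the resulting shortcut closes an odd walk that is shorter.
\<close>

lemma closed_walks_step:
  "4 * \<alpha> * closed_walks (j + 5) \<le> 2 * closed_walks 2 + 2 * closed_walks (j + 3) + closed_walks 4 + closed_walks 6"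
proof -
  have "4 * \<alpha> * closed_walks (j + 5) =
      avg (\<lambda>a. avg (\<lambda>b. avg (\<lambda>c. avg (\<lambda>d. 4 * \<alpha> * (D 0 a b * D 2 b c * D 0 c d * D j d a)))))"
    using closed_walks_add4[of 0 2 0 j] by (simp add: avg_mult_left add_ac)
  also have "\<dots> \<le> avg (\<lambda>a. avg (\<lambda>b. avg (\<lambda>c. avg (\<lambda>d.
       A a b * codeg a b + A c d * codeg c d
       + D (Suc 0) a c * D 0 c d * D j d a + D 0 a b * D (Suc 0) b d * D j d a
       + D 2 b c * D (Suc 0) c b + D 0 a b * D 2 b c * D 0 c d * D (Suc 0) d a))))"
  proof (rule quad_avg)
    fix a b c d assume V: "a \<in> V" "b \<in> V" "c \<in> V" "d \<in> V"
    define g where "g = A a b * D 2 b c * A c d * D j d a"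
    have dropl: "0 \<le> x \<Longrightarrow> x \<le> 1 \<Longrightarrow> 0 \<le> y \<Longrightarrow> x * y \<le> y" for x y :: real
      by (rule mult_left_le_one_le)
    have "4 * \<alpha> * g \<le> (codeg a b + codeg a c + codeg a d + codeg b c + codeg b d + codeg c d) * g"
      by (intro mult_right_mono four_vertices V) (simp add: g_def)
    also have "\<dots> = g * codeg a b + g * codeg c d + g * codeg a c + g * codeg b d + g * codeg b c + g * codeg a d"
      by (simp add: algebra_simps)
    also have "\<dots> \<le> A a b * codeg a b + A c d * codeg c d + codeg a c * A c d * D j d a
        + A a b * codeg b d * D j d a + D 2 b c * codeg b c + A a b * D 2 b c * A c d * codeg a d"
    proof (intro add_mono)
      have "(D 2 b c * A c d * D j d a) * (A a b * codeg a b) \<le> A a b * codeg a b"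
        by (rule dropl) (auto intro!: mult_le_one)
      then show "g * codeg a b \<le> A a b * codeg a b" by (simp add: g_def mult_ac)
      have "(A a b * D 2 b c * D j d a) * (A c d * codeg c d) \<le> A c d * codeg c d"
        by (rule dropl) (auto intro!: mult_le_one)
      then show "g * codeg c d \<le> A c d * codeg c d" by (simp add: g_def mult_ac)
      have "(A a b * D 2 b c) * (codeg a c * A c d * D j d a) \<le> codeg a c * A c d * D j d a"
        by (rule dropl) (auto intro!: mult_le_one)
      then show "g * codeg a c \<le> codeg a c * A c d * D j d a" by (simp add: g_def mult_ac)
      have "(D 2 b c * A c d) * (A a b * codeg b d * D j d a) \<le> A a b * codeg b d * D j d a"
        by (rule dropl) (auto intro!: mult_le_one)
      then show "g * codeg b d \<le> A a b * codeg b d * D j d a" by (simp add: g_def mult_ac)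
      have "(A a b * A c d * D j d a) * (D 2 b c * codeg b c) \<le> D 2 b c * codeg b c"
        by (rule dropl) (auto intro!: mult_le_one)
      then show "g * codeg b c \<le> D 2 b c * codeg b c" by (simp add: g_def mult_ac)
      have "D j d a * (A a b * D 2 b c * A c d * codeg a d) \<le> A a b * D 2 b c * A c d * codeg a d"
        by (rule dropl) auto
      then show "g * codeg a d \<le> A a b * D 2 b c * A c d * codeg a d" by (simp add: g_def mult_ac)
    qed
    finally show "4 * \<alpha> * (D 0 a b * D 2 b c * D 0 c d * D j d a) \<le> A a b * codeg a b + A c d * codeg c d
       + D (Suc 0) a c * D 0 c d * D j d a + D 0 a b * D (Suc 0) b d * D j d a
       + D 2 b c * D (Suc 0) c b + D 0 a b * D 2 b c * D 0 c d * D (Suc 0) d a"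
      by (simp add: g_def D_1 D.simps(1) codeg_sym[of c b] codeg_sym[of d a])
  qed
  also have "\<dots> = 2 * closed_walks 2 + 2 * closed_walks (j + 3) + closed_walks 4 + closed_walks 6"
    using closed_walks_add3[of "Suc 0" 0 j] closed_walks_add3[of 0 "Suc 0" j] closed_walks_add[of 2 "Suc 0"]
      closed_walks_add4[of 0 2 0 "Suc 0"]
    by (simp add: avg_add closed_walks_2 add_ac eval_nat_numeral)
  finally show ?thesis .
qed

lemma closed_walks_small:
  assumes "closed_walks 2 \<le> 2 * \<xi>" "closed_walks 4 \<le> 2 * \<xi>" "closed_walks 6 \<le> 2 * \<xi>"
  shows "closed_walks (6 + 2 * j) \<le> closed_walks_const \<alpha> j * \<xi>"
proof (induction j)
  case (Suc j)
  have "4 * \<alpha> * closed_walks (2 * j + 3 + 5) \<le> 8 * \<xi> + 2 * (closed_walks_const \<alpha> j * \<xi>)"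
    using closed_walks_step[of "2 * j + 3"] assms Suc by (simp add: add_ac)
  then have "closed_walks (2 * j + 3 + 5) \<le> (8 * \<xi> + 2 * (closed_walks_const \<alpha> j * \<xi>)) / (4 * \<alpha>)"
    using \<alpha>_pos by (simp add: pos_le_divide_eq mult_ac)
  then show ?case by (simp add: add_ac algebra_simps add_divide_distrib)
qed (use assms in simp)

text \<open>
  Most pairs of neighbours \<open>s\<close> of \<open>v\<close> and \<open>r\<close> of \<open>w\<close> are joined by many walks of length 3 if the
  edge \<open>vw\<close> lies in few closed walks of length 5 and 7: the other terms in the bound are then
  small on average. Concatenating these links along an odd closed walk of length \<open>g\<close> yields many
  closed walks of odd length \<open>3 g\<close>.
\<close>

lemma link:
  assumes "s \<in> V" "r \<in> V"
  shows "\<alpha> / 4 \<le> codeg s r + D 3 s r + D 2 s s + D 2 r r + 2 * D 2 s r"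
proof -
  have "\<alpha> / 4 = 4 * \<alpha> * (1 / 4 * (1 / 4))" by simp
  also have "\<dots> \<le> 4 * \<alpha> * (avg (A s) * avg (A r))"
    using \<alpha>_pos assms deg'[of s] deg'[of r] by (intro mult_left_mono mult_mono) auto
  also have "\<dots> = avg (\<lambda>p. avg (\<lambda>q. 4 * \<alpha> * (A s p * A r q)))"
    by (simp add: avg_mult_left avg_mult_right)
  \<comment> \<open>A common neighbour of \<open>q\<close>, \<open>s\<close> or of \<open>p\<close>,
    \<open>r\<close> completes one of the desired walks of length 3 between \<open>s\<close> and
    \<open>r\<close>; the other four pairs are the error.\<close>
  also have "\<dots> \<le> avg (\<lambda>p. avg (\<lambda>q. codeg s r + A s p * codeg p q * A q r + A s p * codeg p s
      + A r q * codeg q r + A r q * codeg q s + A s p * codeg p r))"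
  proof (intro avg_mono)
    fix p q assume V: "p \<in> V" "q \<in> V"
    show "4 * \<alpha> * (A s p * A r q) \<le> codeg s r + A s p * codeg p q * A q r + A s p * codeg p s
      + A r q * codeg q r + A r q * codeg q s + A s p * codeg p r"
    proof (cases "A s p = 0 \<or> A r q = 0")
      case True then show ?thesis by (auto intro!: add_nonneg_nonneg)
    next
      case False
      then have "A s p = 1" "A r q = 1" "A q r = 1"
        using A01[of s p] A01[of r q] A_sym[of q r] by auto
      then show ?thesis using four_vertices[OF assms V]
        by (simp add: codeg_sym[of p s] codeg_sym[of q s] codeg_sym[of q r] codeg_sym[of p r])
    qed
  qed
  also have "\<dots> = codeg s r + D 3 s r + D 2 s s + D 2 r r + 2 * D 2 s r"
    by (simp add: avg_add D3_eq D2_left D_sym[of 2 r s])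
  finally show ?thesis .
qed

text \<open>The truncation at \<open>1\<close> keeps products of two errors below a single one.\<close>

definition err :: "'v \<Rightarrow> 'v \<Rightarrow> real" where
  "err s r = min 1 (4 / \<alpha> * (codeg s r + D 3 s r + D 2 s s + D 2 r r))"

lemma err_nonneg: "0 \<le> err s r" and err_le_1: "err s r \<le> 1"
  using \<alpha>_pos by (auto simp: err_def intro!: mult_nonneg_nonneg divide_nonneg_pos add_nonneg_nonneg)

lemma link_err:
  assumes "s \<in> V" "r \<in> V"
  shows "1 \<le> 8 / \<alpha> * D 2 s r + err s r"
proof -
  have "1 = 4 / \<alpha> * (\<alpha> / 4)" using \<alpha>_pos by simp
  also have "\<dots> \<le> 4 / \<alpha> * (codeg s r + D 3 s r + D 2 s s + D 2 r r + 2 * D 2 s r)"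
    using \<alpha>_pos by (intro mult_left_mono link assms) auto
  finally have "1 \<le> 8 / \<alpha> * D 2 s r + 4 / \<alpha> * (codeg s r + D 3 s r + D 2 s s + D 2 r r)"
    by (simp add: algebra_simps)
  moreover have "0 \<le> 8 / \<alpha> * D 2 s r" using \<alpha>_pos by simp
  ultimately show ?thesis unfolding err_def by linarith
qed

text \<open>Prefixing \<open>v\<close> and appending \<open>w\<close> lengthens the walks from
  \<open>s\<close> to \<open>r\<close> by two edges: the codegree turns into \<open>D 3 v w\<close>,
  and \<open>D 3 s r\<close> into \<open>D 5 v w\<close>, which is where walks of length 6 enter.
  Each of the two triangle terms averages to \<open>closed_walks 2\<close>, which makes
  \<open>6 * \<xi>\<close> in total.\<close>

lemma avg_err:
  assumes "D 3 v w \<le> \<xi>" "D 5 v w \<le> \<xi>" "closed_walks 2 \<le> 2 * \<xi>"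
  shows "avg (\<lambda>s. avg (\<lambda>r. A v s * err s r * A r w)) \<le> 24 / \<alpha> * \<xi>"
proof -
  have "avg (\<lambda>s. avg (\<lambda>r. A v s * err s r * A r w)) \<le>
      avg (\<lambda>s. avg (\<lambda>r. 4 / \<alpha> * (A v s * codeg s r * A r w + A v s * D 3 s r * A r w + D 2 s s + D 2 r r)))"
  proof (intro avg_mono)
    fix s r
    have "A v s * err s r * A r w = (A v s * A r w) * err s r" by simp
    also have "\<dots> \<le> (A v s * A r w) * (4 / \<alpha> * (codeg s r + D 3 s r + D 2 s s + D 2 r r))"
      by (intro mult_left_mono) (auto simp: err_def)
    also have "\<dots> = 4 / \<alpha> * (A v s * codeg s r * A r w + A v s * D 3 s r * A r w
        + (A v s * A r w) * D 2 s s + (A v s * A r w) * D 2 r r)"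
      by (simp add: algebra_simps)
    also have "\<dots> \<le> 4 / \<alpha> * (A v s * codeg s r * A r w + A v s * D 3 s r * A r w + D 2 s s + D 2 r r)"
      using \<alpha>_pos by (intro mult_left_mono add_mono order_refl mult_left_le_one_le) (auto intro!: mult_le_one)
    finally show "A v s * err s r * A r w \<le>
      4 / \<alpha> * (A v s * codeg s r * A r w + A v s * D 3 s r * A r w + D 2 s s + D 2 r r)" .
  qed
  also have "\<dots> = 4 / \<alpha> * (D 3 v w + D 5 v w + 2 * closed_walks 2)"
  proof -
    have "avg (\<lambda>s. avg (\<lambda>r. A v s * D 3 s r * A r w)) = D 5 v w"
      using D_Suc_Suc[of 3 v w] by (simp add: eval_nat_numeral)
    then show ?thesis
      by (simp only: avg_mult_left avg_add D3_eq avg_const closed_walks_def[symmetric]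
          mult_2 add.assoc)
  qed
  also have "\<dots> \<le> 4 / \<alpha> * (6 * \<xi>)" using assms \<alpha>_pos by (intro mult_left_mono) auto
  finally show ?thesis by simp
qed

text \<open>The product of the errors is at most \<open>e\<close> because \<open>e'\<close> is at
  most 1. The bound is thus linear in the errors, and they can be averaged separately.\<close>

lemma link_product:
  assumes "0 \<le> d" "d \<le> 1" "0 \<le> d'" "d' \<le> 1" "0 \<le> e" "0 \<le> e'" "e' \<le> 1" "0 \<le> C" "0 \<le> (C'::real)"
    "1 \<le> C * d + e" "1 \<le> C' * d' + e'"
  shows "1 \<le> C * C' * (d * d') + ((C' + 1) * e + C * e')"
proof -
  have "1 * 1 \<le> (C * d + e) * (C' * d' + e')" using assms by (intro mult_mono) auto
  also have "\<dots> = C * C' * (d * d') + (d * (C * e') + d' * (C' * e) + e' * e)"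
    by (simp add: algebra_simps)
  also have "\<dots> \<le> C * C' * (d * d') + (C * e' + C' * e + e)"
    using assms by (intro add_mono order_refl mult_left_le_one_le) auto
  finally show ?thesis by (simp add: algebra_simps)
qed

text \<open>The inequality holds for all pairs \<open>s\<close>, \<open>t\<close>, but
  \<open>e\<close> is small only on average between the neighbourhoods of the two end vertices. It
  is existential because it is assembled edge by edge.\<close>

lemma link_chain:
  assumes "\<And>i. v i \<in> V" "\<And>i. i \<le> k \<Longrightarrow> D 3 (v i) (v (Suc i)) \<le> \<xi>"
    "\<And>i. i \<le> k \<Longrightarrow> D 5 (v i) (v (Suc i)) \<le> \<xi>" "closed_walks 2 \<le> 2 * \<xi>"
  shows "\<exists>e. (\<forall>s\<in>V. \<forall>t\<in>V. 0 \<le> e s t \<and> 1 \<le> link_const \<alpha> k * D (3 * k + 2) s t + e s t) \<and>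
    avg (\<lambda>s. avg (\<lambda>t. A (v 0) s * e s t * A t (v (Suc k)))) \<le> link_error \<alpha> k * \<xi>"
  using assms(2,3)
proof (induction k)
  case 0
  have "avg (\<lambda>s. avg (\<lambda>t. A (v 0) s * err s t * A t (v (Suc 0)))) \<le> 24 / \<alpha> * \<xi>"
    using 0 assms(4) by (intro avg_err) auto
  then show ?case using link_err err_nonneg by (intro exI[of _ err]) (auto simp: numeral_2_eq_2)
next
  case (Suc k)
  then obtain e where e: "\<And>s t. s \<in> V \<Longrightarrow> t \<in> V \<Longrightarrow> 0 \<le> e s t"
      "\<And>s t. s \<in> V \<Longrightarrow> t \<in> V \<Longrightarrow> 1 \<le> link_const \<alpha> k * D (3 * k + 2) s t + e s t"
    and ae: "avg (\<lambda>s. avg (\<lambda>t. A (v 0) s * e s t * A t (v (Suc k)))) \<le> link_error \<alpha> k * \<xi>"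
    by force
  define C where "C = link_const \<alpha> k"
  define C' where "C' = 8 / \<alpha>"
  have C0: "0 \<le> C" "0 \<le> C'" using \<alpha>_pos link_const_pos[of \<alpha> k] by (auto simp: C_def C'_def)
  let ?v = "v (Suc k)" and ?w = "v (Suc (Suc k))"
  define h where "h s t r = (C' + 1) * e s t + C * err t r" for s t r
  have h0: "0 \<le> h s t r" if "s \<in> V" "t \<in> V" for s t r
    using that e C0 err_nonneg by (auto simp: h_def)
  \<comment> \<open>The link is routed through a neighbour \<open>t\<close> of \<open>?v\<close>;
    the factor 4 compensates for the density of this neighbourhood, which may be as low as
    1/4.\<close>
  define e' where "e' s r = 4 * avg (\<lambda>t. A ?v t * h s t r)" for s r
  have "0 \<le> e' s r" if "s \<in> V" for s r
    unfolding e'_def using that h0 by (auto intro!: avg_nonneg mult_nonneg_nonneg)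
  moreover have "1 \<le> link_const \<alpha> (Suc k) * D (3 * Suc k + 2) s r + e' s r" if "s \<in> V" "r \<in> V" for s r
  proof -
    have "1 / 4 \<le> avg (\<lambda>t. A ?v t * 1)" using deg'[OF assms(1)] by simp
    also have "\<dots> \<le> avg (\<lambda>t. C * C' * (D (3 * k + 2) s t * D 2 t r) + A ?v t * h s t r)"
    proof (rule avg_mono)
      fix t assume t: "t \<in> V"
      have "1 \<le> C * C' * (D (3 * k + 2) s t * D 2 t r) + h s t r"
        unfolding h_def using e[OF that(1) t] err_nonneg err_le_1 C0 link_err[OF t that(2)]
        by (intro link_product) (auto simp: C_def C'_def)
      then have "A ?v t * 1 \<le> A ?v t * (C * C' * (D (3 * k + 2) s t * D 2 t r)) + A ?v t * h s t r"
        unfolding distrib_left[symmetric] by (intro mult_left_mono) auto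
      also have "A ?v t * (C * C' * (D (3 * k + 2) s t * D 2 t r)) \<le> C * C' * (D (3 * k + 2) s t * D 2 t r)"
        using C0 by (intro mult_left_le_one_le) auto
      finally show "A ?v t * 1 \<le> C * C' * (D (3 * k + 2) s t * D 2 t r) + A ?v t * h s t r" by simp
    qed
    also have "\<dots> = C * C' * D (3 * Suc k + 2) s r + e' s r / 4"
      using D_add[of "3 * k + 2" 2 s r] by (simp add: avg_add avg_mult_left e'_def eval_nat_numeral)
    finally show ?thesis by (simp add: C_def C'_def)
  qed
  moreover have "avg (\<lambda>s. avg (\<lambda>r. A (v 0) s * e' s r * A r ?w)) \<le> link_error \<alpha> (Suc k) * \<xi>"
  proof -
    have "avg (\<lambda>s. avg (\<lambda>r. A (v 0) s * e' s r * A r ?w)) =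
        4 * avg (\<lambda>s. avg (\<lambda>r. avg (\<lambda>t. A (v 0) s * (A ?v t * h s t r) * A r ?w)))"
      by (simp add: e'_def avg_mult_left[symmetric] avg_mult_right[symmetric] mult_ac)
    also have "\<dots> \<le> 4 * avg (\<lambda>s. avg (\<lambda>r. avg (\<lambda>t. (C' + 1) * (A (v 0) s * e s t * A t ?v)
        + C * (A ?v t * err t r * A r ?w))))"
    proof (intro mult_left_mono triple_avg)
      fix s r t assume W: "s \<in> V" "r \<in> V" "t \<in> V"
      have "A (v 0) s * (A ?v t * h s t r) * A r ?w =
          A r ?w * ((C' + 1) * (A (v 0) s * e s t * A t ?v)) + A (v 0) s * (C * (A ?v t * err t r * A r ?w))"
        by (simp add: h_def A_sym[of t] algebra_simps)
      also have "\<dots> \<le> (C' + 1) * (A (v 0) s * e s t * A t ?v) + C * (A ?v t * err t r * A r ?w)"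
        using e[OF W(1,3)] C0 err_nonneg by (intro add_mono mult_left_le_one_le) auto
      finally show "A (v 0) s * (A ?v t * h s t r) * A r ?w
        \<le> (C' + 1) * (A (v 0) s * e s t * A t ?v) + C * (A ?v t * err t r * A r ?w)" .
    qed simp
    also have "\<dots> = 4 * ((C' + 1) * avg (\<lambda>s. avg (\<lambda>t. A (v 0) s * e s t * A t ?v))
        + C * avg (\<lambda>t. avg (\<lambda>r. A ?v t * err t r * A r ?w)))"
      by (subst (3) avg_swap) (simp only: avg_add avg_mult_left avg_const)
    also have "\<dots> \<le> 4 * ((C' + 1) * (link_error \<alpha> k * \<xi>) + C * (24 / \<alpha> * \<xi>))"
      using Suc.prems assms(4) C0 ae by (intro mult_left_mono add_mono avg_err) auto
    also have "\<dots> = link_error \<alpha> (Suc k) * \<xi>" by (simp add: C_def C'_def algebra_simps)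
    finally show ?thesis .
  qed
  ultimately show ?case by (intro exI[of _ e']) auto
qed

text \<open>\<open>link_chain\<close> runs along the first \<open>2 * l + 2\<close> edges and
  \<open>link_err\<close> covers the closing edge. Unless the errors are large, most pairs of
  neighbours of the two ends lie on closed walks of odd length, whose density
  \<open>closed_walks_small\<close> bounds; 1/16 is the least possible density of such
  pairs.\<close>

lemma odd_walk_dense_edge:
  assumes "\<And>i. v i \<in> V"
    "\<And>i. i < 2 * l + 2 \<Longrightarrow> D 3 (v i) (v (Suc i)) \<le> \<xi> \<and> D 5 (v i) (v (Suc i)) \<le> \<xi>"
    "D 3 (v (2 * l + 2)) (v 0) \<le> \<xi>" "D 5 (v (2 * l + 2)) (v 0) \<le> \<xi>"
    "closed_walks 2 \<le> 2 * \<xi>" "closed_walks 4 \<le> 2 * \<xi>" "closed_walks 6 \<le> 2 * \<xi>"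
  shows "1 / 16 \<le> odd_walk_const \<alpha> l * \<xi>"
proof -
  define k where "k = 2 * l + 1"
  define C where "C = link_const \<alpha> k"
  define C' where "C' = 8 / \<alpha>"
  have C0: "0 \<le> C" "0 \<le> C'" using \<alpha>_pos link_const_pos[of \<alpha> k] by (auto simp: C_def C'_def)
  let ?w = "v (Suc k)"
  have "\<exists>e. (\<forall>s\<in>V. \<forall>t\<in>V. 0 \<le> e s t \<and> 1 \<le> C * D (3 * k + 2) s t + e s t) \<and>
    avg (\<lambda>s. avg (\<lambda>t. A (v 0) s * e s t * A t ?w)) \<le> link_error \<alpha> k * \<xi>"
    unfolding C_def by (rule link_chain) (use assms in \<open>auto simp: k_def\<close>)
  then obtain e where e: "\<And>s t. s \<in> V \<Longrightarrow> t \<in> V \<Longrightarrow> 0 \<le> e s t"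
      "\<And>s t. s \<in> V \<Longrightarrow> t \<in> V \<Longrightarrow> 1 \<le> C * D (3 * k + 2) s t + e s t"
    and ae: "avg (\<lambda>s. avg (\<lambda>t. A (v 0) s * e s t * A t ?w)) \<le> link_error \<alpha> k * \<xi>"
    by force
  have "1 / 16 = 1 / 4 * (1 / 4::real)" by simp
  also have "\<dots> \<le> avg (A (v 0)) * avg (A ?w)"
    using deg'[OF assms(1)] by (intro mult_mono) (auto intro: avg_nonneg)
  also have "\<dots> = avg (\<lambda>s. avg (\<lambda>t. A (v 0) s * A ?w t * 1))"
    by (simp add: avg_mult_left avg_mult_right)
  also have "\<dots> \<le> avg (\<lambda>s. avg (\<lambda>t. C * C' * (D (3 * k + 2) s t * D 2 t s)
      + ((C' + 1) * (A (v 0) s * e s t * A t ?w) + C * (A ?w t * err t s * A s (v 0)))))"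
  proof (intro avg_mono)
    fix s t assume V: "s \<in> V" "t \<in> V"
    have "1 \<le> C * C' * (D (3 * k + 2) s t * D 2 t s) + ((C' + 1) * e s t + C * err t s)"
      using e[OF V] err_nonneg err_le_1 C0 link_err[OF V(2,1)]
      by (intro link_product) (auto simp: C'_def)
    then have "A (v 0) s * A ?w t * 1 \<le> A (v 0) s * A ?w t *
        (C * C' * (D (3 * k + 2) s t * D 2 t s) + ((C' + 1) * e s t + C * err t s))"
      by (intro mult_left_mono) auto
    also have "\<dots> = (A (v 0) s * A ?w t) * (C * C' * (D (3 * k + 2) s t * D 2 t s)) +
        ((C' + 1) * (A (v 0) s * e s t * A t ?w) + C * (A ?w t * err t s * A s (v 0)))"
      by (simp add: A_sym[of t] A_sym[of s] algebra_simps)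
    also have "\<dots> \<le> C * C' * (D (3 * k + 2) s t * D 2 t s)
      + ((C' + 1) * (A (v 0) s * e s t * A t ?w) + C * (A ?w t * err t s * A s (v 0)))"
      using C0 by (intro add_right_mono mult_left_le_one_le) (auto intro!: mult_le_one)
    finally show "A (v 0) s * A ?w t * 1 \<le> C * C' * (D (3 * k + 2) s t * D 2 t s)
      + ((C' + 1) * (A (v 0) s * e s t * A t ?w) + C * (A ?w t * err t s * A s (v 0)))" .
  qed
  also have "\<dots> = C * C' * closed_walks (Suc (3 * k + 2 + 2)) +
      ((C' + 1) * avg (\<lambda>s. avg (\<lambda>t. A (v 0) s * e s t * A t ?w))
        + C * avg (\<lambda>s. avg (\<lambda>t. A ?w t * err t s * A s (v 0))))"
    by (simp only: avg_add avg_mult_left closed_walks_add)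
  \<comment> \<open>Three edges for each of \<open>2 * l + 3\<close> links give length
    \<open>6 * l + 9\<close>, hence index \<open>6 * l + 8\<close>.\<close>
  also have "Suc (3 * k + 2 + 2) = 6 + 2 * (3 * l + 1)" by (simp add: k_def)
  also have "avg (\<lambda>s. avg (\<lambda>t. A ?w t * err t s * A s (v 0)))
      = avg (\<lambda>t. avg (\<lambda>s. A ?w t * err t s * A s (v 0)))" by (rule avg_swap)
  also have "C * C' * closed_walks (6 + 2 * (3 * l + 1)) +
      ((C' + 1) * avg (\<lambda>s. avg (\<lambda>t. A (v 0) s * e s t * A t ?w))
        + C * avg (\<lambda>t. avg (\<lambda>s. A ?w t * err t s * A s (v 0))))
    \<le> C * C' * (closed_walks_const \<alpha> (3 * l + 1) * \<xi>) + ((C' + 1) * (link_error \<alpha> k * \<xi>) + C * (24 / \<alpha> * \<xi>))"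
    using ae C0 assms by (intro add_mono mult_left_mono avg_err closed_walks_small) (auto simp: k_def)
  also have "\<dots> = odd_walk_const \<alpha> l * \<xi>"
    by (simp add: odd_walk_const_def C_def C'_def k_def algebra_simps)
  finally show ?thesis .
qed

end

section \<open>Counting copies through an edge\<close>

text \<open>Every \<open>u\<close> draws a pair and \<open>\<kappa> u\<close> keeps one coordinate
  of it. By \<open>fibre\<close> this coordinate is uniformly distributed on \<open>V\<close>, so
  all maps \<open>f\<close> have equally many preimages among the \<open>q\<close>, and the bound of
  \<open>complete_bipartite_count\<close> passes to the \<open>f\<close>.\<close>

lemma hom_count:
  fixes M :: "'o \<Rightarrow> 'e \<Rightarrow> bool" and \<eta> :: real and \<kappa> :: "'a \<Rightarrow> 'o \<times> 'e \<Rightarrow> 'v"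
  assumes fin: "finite X" "finite Y" "finite U" "finite V" and ne: "X \<noteq> {}" "Y \<noteq> {}" "V \<noteq> {}"
    and "\<eta> \<ge> 0"
    and dense: "\<eta> * real (card X * card Y) \<le> real (card {(x, y). x \<in> X \<and> y \<in> Y \<and> M x y})"
    and \<kappa>: "\<And>u q. u \<in> U \<Longrightarrow> q \<in> X \<times> Y \<Longrightarrow> \<kappa> u q \<in> V"
    and fibre: "\<And>u v. u \<in> U \<Longrightarrow> v \<in> V \<Longrightarrow> card {q \<in> X \<times> Y. \<kappa> u q = v} * card V = card X * card Y"
    and P: "\<And>q. q \<in> U \<rightarrow>\<^sub>E X \<times> Y \<Longrightarrow> (\<And>u u'. u \<in> U \<Longrightarrow> u' \<in> U \<Longrightarrow> M (fst (q u)) (snd (q u'))) \<Longrightarrow>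
      P (\<lambda>u\<in>U. \<kappa> u (q u))"
  shows "\<eta> ^ (card U * card U) * real (card V) ^ card U \<le> real (card {f \<in> U \<rightarrow>\<^sub>E V. P f})"
proof -
  let ?F = "{f \<in> U \<rightarrow>\<^sub>E V. P f}" and ?t = "card U"
  let ?Q = "{q \<in> U \<rightarrow>\<^sub>E X \<times> Y. \<forall>u\<in>U. \<forall>u'\<in>U. M (fst (q u)) (snd (q u'))}"
  let ?R = "\<lambda>f. Pi\<^sub>E U (\<lambda>u. {q \<in> X \<times> Y. \<kappa> u q = f u})"
  have n0: "real (card V) > 0" using fin ne by (simp add: card_gt_0_iff)
  have xy0: "real (card X * card Y) > 0" using fin ne by (simp add: card_gt_0_iff)
  have finF: "finite ?F" using fin by (auto intro!: finite_subset[OF _ finite_PiE[of U "\<lambda>_. V"]])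
  have sub: "?Q \<subseteq> (\<Union>f\<in>?F. ?R f)"
  proof
    fix q assume q: "q \<in> ?Q"
    define f where "f = (\<lambda>u\<in>U. \<kappa> u (q u))"
    have "P f" unfolding f_def using q by (intro P) auto
    moreover have "f \<in> U \<rightarrow>\<^sub>E V" using q \<kappa> by (auto simp: f_def PiE_iff)
    moreover have "q \<in> ?R f" using q by (auto simp: f_def PiE_iff)
    ultimately show "q \<in> (\<Union>f\<in>?F. ?R f)" by blast
  qed
  have cR: "card (?R f) * card V ^ ?t = (card X * card Y) ^ ?t" if "f \<in> ?F" for f
  proof -
    have "card (?R f) * card V ^ ?t = (\<Prod>u\<in>U. card {q \<in> X \<times> Y. \<kappa> u q = f u} * card V)"
      using fin by (simp add: card_PiE prod.distrib)
    also have "\<dots> = (\<Prod>u\<in>U. card X * card Y)"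
      using that by (intro prod.cong refl fibre) (auto simp: PiE_iff)
    finally show ?thesis by simp
  qed
  have "card ?Q \<le> card (\<Union>f\<in>?F. ?R f)"
    using sub fin finF by (intro card_mono) (auto intro!: finite_PiE)
  also have "\<dots> \<le> (\<Sum>f\<in>?F. card (?R f))" by (rule card_UN_le[OF finF])
  finally have "card ?Q * card V ^ ?t \<le> (\<Sum>f\<in>?F. card (?R f)) * card V ^ ?t" by simp
  also have "\<dots> = card ?F * (card X * card Y) ^ ?t"
    using cR by (simp add: sum_distrib_right)
  finally have "real (card ?Q * card V ^ ?t) \<le> real (card ?F * (card X * card Y) ^ ?t)"
    by (rule of_nat_mono)
  moreover have "\<eta> ^ (?t * ?t) * real (card X * card Y) ^ ?t \<le> real (card ?Q)"
    by (rule complete_bipartite_count) (use assms in auto)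
  then have "\<eta> ^ (?t * ?t) * real (card X * card Y) ^ ?t * real (card V) ^ ?t
      \<le> real (card ?Q) * real (card V) ^ ?t" by (rule mult_right_mono) simp
  ultimately have "\<eta> ^ (?t * ?t) * real (card X * card Y) ^ ?t * real (card V) ^ ?t
      \<le> real (card ?F) * real (card X * card Y) ^ ?t"
    unfolding of_nat_mult[of "card ?Q"] of_nat_mult[of "card ?F"] of_nat_power by linarith
  then have "(\<eta> ^ (?t * ?t) * real (card V) ^ ?t) * real (card X * card Y) ^ ?t
      \<le> real (card ?F) * real (card X * card Y) ^ ?t" by (simp only: mult_ac)
  then show ?thesis using xy0 by (simp only: mult_le_cancel_right_pos zero_less_power)
qed

lemma card_determined_le:
  assumes "finite U" "finite V" "u \<in> U" "S \<subseteq> U \<rightarrow>\<^sub>E V"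
    and det: "\<And>f g. f \<in> S \<Longrightarrow> g \<in> S \<Longrightarrow> (\<And>w. w \<in> U - {u} \<Longrightarrow> f w = g w) \<Longrightarrow> f u = g u"
  shows "card S \<le> card V ^ (card U - 1)"
proof -
  have "card S \<le> card ((U - {u}) \<rightarrow>\<^sub>E V)"
  proof (rule card_inj_on_le[where f = "\<lambda>f. restrict f (U - {u})"])
    show "inj_on (\<lambda>f. restrict f (U - {u})) S"
    proof (rule inj_onI)
      fix f g assume fg: "f \<in> S" "g \<in> S" and eq: "restrict f (U - {u}) = restrict g (U - {u})"
      have a: "f w = g w" if "w \<in> U - {u}" for w
        using fun_cong[OF eq, of w] that by simp
      then have "f u = g u" using fg det by blast
      then show "f = g" using a fg assms(4) by (intro PiE_ext[of f U "\<lambda>_. V" g]) auto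
    qed
    show "(\<lambda>f. restrict f (U - {u})) ` S \<subseteq> (U - {u}) \<rightarrow>\<^sub>E V"
    proof clarify
      fix f assume "f \<in> S"
      then have "f \<in> U \<rightarrow>\<^sub>E V" using assms(4) by auto
      then show "restrict f (U - {u}) \<in> (U - {u}) \<rightarrow>\<^sub>E V" by (auto simp: PiE_iff)
    qed
  qed (use assms in \<open>auto intro!: finite_PiE\<close>)
  also have "\<dots> = card V ^ (card U - 1)" using assms by (simp add: card_PiE)
  finally show ?thesis .
qed

text \<open>An extended map fails to be injective only if some vertex of \<open>U\<close> goes to
  \<open>a\<close> or \<open>b\<close>, or two vertices of \<open>U\<close> collide. Each such event
  determines one value from the others, and the number of events is at most the square of
  \<open>card U + 2\<close>.\<close>

lemma labelled_copies_through_edge: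
  fixes H :: "'a pair_pre_digraph" and G :: "'b pair_pre_digraph"
  assumes "pair_graph H" "pair_graph G" "(x, y) \<in> parcs H" "(a, b) \<in> parcs G"
    and U: "U = pverts H - {x, y}"
    and homs: "K \<le> real (card {f \<in> U \<rightarrow>\<^sub>E pverts G.
      \<forall>(u, w) \<in> parcs H. ((f(x := a, y := b)) u, (f(x := a, y := b)) w) \<in> parcs G})"
  shows "K - real (card (pverts H) ^ 2 * card (pverts G) ^ (card U - 1))
    \<le> real (card {f \<in> labelled_copies H G. f x = a \<and> f y = b})"
proof -
  interpret H: pair_graph H by fact
  interpret G: pair_graph G by fact
  let ?V = "pverts G" and ?e = "\<lambda>f. f(x := a, y := b)" and ?m = "card (pverts G) ^ (card U - 1)"
  define F where "F = {f \<in> U \<rightarrow>\<^sub>E ?V. \<forall>(u, w) \<in> parcs H. (?e f u, ?e f w) \<in> parcs G}"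
  have fins: "finite U" "finite ?V" "finite (pverts H)"
    using U H.pair_finite_verts G.pair_finite_verts by auto
  have finF: "finite F" unfolding F_def
    using fins by (auto intro!: finite_subset[OF _ finite_PiE[of U "\<lambda>_. ?V"]])
  have xy: "x \<noteq> y" "x \<in> pverts H" "y \<in> pverts H"
    using assms(3) H.no_loops' H.in_arcsD1 H.in_arcsD2 by auto
  have ab: "a \<noteq> b" "a \<in> ?V" "b \<in> ?V"
    using assms(4) G.no_loops' G.in_arcsD1 G.in_arcsD2 by auto
  define I where "I = {f \<in> F. inj_on (?e f) (pverts H)}"
  define B1 where "B1 = (\<lambda>(u, c). {f \<in> U \<rightarrow>\<^sub>E ?V. f u = c})"
  define B2 where "B2 = (\<lambda>(u, w). {f \<in> U \<rightarrow>\<^sub>E ?V. f u = f w})"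
  have sub: "F \<subseteq> I \<union> ((\<Union>p \<in> U \<times> {a, b}. B1 p) \<union> (\<Union>p \<in> U \<times> U - Id. B2 p))"
  proof
    fix f assume f: "f \<in> F"
    show "f \<in> I \<union> ((\<Union>p \<in> U \<times> {a, b}. B1 p) \<union> (\<Union>p \<in> U \<times> U - Id. B2 p))"
    proof (rule ccontr)
      assume n: "f \<notin> I \<union> ((\<Union>p \<in> U \<times> {a, b}. B1 p) \<union> (\<Union>p \<in> U \<times> U - Id. B2 p))"
      have fE: "f \<in> U \<rightarrow>\<^sub>E ?V" using f by (simp add: F_def)
      have 1: "f u \<noteq> a" "f u \<noteq> b" if "u \<in> U" for u
        using n fE that by (auto simp: B1_def)
      have 2: "f u \<noteq> f w" if "u \<in> U" "w \<in> U" "u \<noteq> w" for u w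
        using n fE that by (auto simp: B2_def)
      have "inj_on (?e f) (pverts H)"
      proof (rule inj_onI)
        fix u w assume "u \<in> pverts H" "w \<in> pverts H" "?e f u = ?e f w"
        then show "u = w" using 1[of u] 1[of w] 2[of u w] ab(1) U
          by (auto split: if_splits)
      qed
      then show False using n f by (simp add: I_def)
    qed
  qed
  have c1: "card (B1 p) \<le> ?m" if pU: "p \<in> U \<times> {a, b}" for p
  proof -
    obtain u c where p: "p = (u, c)" "u \<in> U" using pU by blast
    show ?thesis unfolding p(1) B1_def prod.case
      by (rule card_determined_le[OF fins(1,2) p(2)]) auto
  qed
  have c2: "card (B2 p) \<le> ?m" if pU: "p \<in> U \<times> U - Id" for p
  proof -
    obtain u w where p: "p = (u, w)" "u \<in> U" "w \<in> U" "u \<noteq> w" using pU by blast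
    show ?thesis unfolding p B2_def prod.case
    proof (rule card_determined_le[OF fins(1,2) p(2)])
      fix f g assume "f \<in> {f \<in> U \<rightarrow>\<^sub>E ?V. f u = f w}" "g \<in> {f \<in> U \<rightarrow>\<^sub>E ?V. f u = f w}"
        "\<And>w. w \<in> U - {u} \<Longrightarrow> f w = g w"
      then show "f u = g u" using p by fastforce
    qed auto
  qed
  have "card F \<le> card I + card ((\<Union>p \<in> U \<times> {a, b}. B1 p) \<union> (\<Union>p \<in> U \<times> U - Id. B2 p))"
  proof (rule order.trans[OF card_mono card_Un_le])
    show "finite (I \<union> ((\<Union>p \<in> U \<times> {a, b}. B1 p) \<union> (\<Union>p \<in> U \<times> U - Id. B2 p)))"
      using fins finF by (auto simp: I_def B1_def B2_def
          intro!: finite_subset[OF _ finite_PiE[of U "\<lambda>_. ?V"]])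
  qed (rule sub)
  also have "\<dots> \<le> card I + (card (\<Union>p \<in> U \<times> {a, b}. B1 p) + card (\<Union>p \<in> U \<times> U - Id. B2 p))"
    by (intro add_left_mono card_Un_le)
  also have "\<dots> \<le> card I + ((\<Sum>p \<in> U \<times> {a, b}. card (B1 p)) + (\<Sum>p \<in> U \<times> U - Id. card (B2 p)))"
    using fins by (intro add_left_mono add_mono card_UN_le) auto
  also have "\<dots> \<le> card I + (card (U \<times> {a, b}) * ?m + card (U \<times> U - Id) * ?m)"
  proof -
    have "(\<Sum>p \<in> U \<times> {a, b}. card (B1 p)) \<le> of_nat (card (U \<times> {a, b})) * ?m"
      by (rule sum_bounded_above, rule c1)
    moreover have "(\<Sum>p \<in> U \<times> U - Id. card (B2 p)) \<le> of_nat (card (U \<times> U - Id)) * ?m"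
      by (rule sum_bounded_above, rule c2)
    ultimately show ?thesis by simp
  qed
  also have "\<dots> \<le> card I + card (pverts H) ^ 2 * ?m"
  proof -
    have "card (U \<times> {a, b}) = 2 * card U" using ab fins by (simp add: card_cartesian_product)
    moreover have "card (U \<times> U - Id) \<le> card U * card U"
      using fins card_mono[of "U \<times> U" "U \<times> U - Id"] by (auto simp: card_cartesian_product)
    moreover have "card U + 2 = card (pverts H)"
    proof -
      have "card {x, y} \<le> card (pverts H)" using xy fins by (intro card_mono) auto
      then show ?thesis using U xy fins by (simp add: card_Diff_subset)
    qed
    ultimately have "card (U \<times> {a, b}) + card (U \<times> U - Id) \<le> card (pverts H) ^ 2"
      by (simp flip: \<open>card U + 2 = card (pverts H)\<close> add: power2_eq_square)
    then have "(card (U \<times> {a, b}) + card (U \<times> U - Id)) * ?m \<le> card (pverts H) ^ 2 * ?m"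
      by (rule mult_le_mono1)
    then show ?thesis by (simp add: add_mult_distrib)
  qed
  also have "card I \<le> card {f \<in> labelled_copies H G. f x = a \<and> f y = b}"
  proof (rule card_inj_on_le[where f = ?e])
    show "inj_on ?e I"
    proof (rule inj_onI)
      fix f g assume fg: "f \<in> I" "g \<in> I" and eq: "?e f = ?e g"
      have "f u = g u" if "u \<in> U" for u
        using fun_cong[OF eq, of u] that U by auto
      then show "f = g" using fg by (intro PiE_ext[of f U "\<lambda>_. ?V" g]) (auto simp: I_def F_def)
    qed
    show "?e ` I \<subseteq> {f \<in> labelled_copies H G. f x = a \<and> f y = b}"
    proof clarify
      fix f assume f: "f \<in> I"
      have fE: "f \<in> U \<rightarrow>\<^sub>E ?V" using f by (simp add: I_def F_def)
      have "?e f \<in> pverts H \<rightarrow>\<^sub>E ?V"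
        using fE ab xy U by (auto simp: PiE_iff extensional_def)
      then show "?e f \<in> labelled_copies H G \<and> ?e f x = a \<and> ?e f y = b"
        using f xy by (auto simp: labelled_copies_def I_def F_def)
    qed
    show "finite {f \<in> labelled_copies H G. f x = a \<and> f y = b}"
      using fins by (auto simp: labelled_copies_def
          intro!: finite_subset[OF _ finite_PiE[of "pverts H" "\<lambda>_. ?V"]])
  qed
  finally have "card F \<le> card {f \<in> labelled_copies H G. f x = a \<and> f y = b} + card (pverts H) ^ 2 * ?m"
    by simp
  then have "real (card F) \<le> real (card {f \<in> labelled_copies H G. f x = a \<and> f y = b} + card (pverts H) ^ 2 * ?m)"
    by (rule of_nat_mono)
  then show ?thesis using homs by (simp add: F_def)
qed

lemma card_rel_of_bool:
  assumes "finite X" "finite Y"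
  shows "real (card {(x, y). x \<in> X \<and> y \<in> Y \<and> M x y}) = (\<Sum>x\<in>X. \<Sum>y\<in>Y. of_bool (M x y))"
  using assms by (simp add: card_rel_sum Int_def)

text \<open>Used in \<open>walks6_count\<close> to bring the middle vertex of a walk of length 6
  next to the other odd positions.\<close>

lemma sum_rotate4:
  fixes f :: "'a \<Rightarrow> 'a \<Rightarrow> 'a \<Rightarrow> 'a \<Rightarrow> 'b::comm_monoid_add"
  shows "(\<Sum>s\<in>V. \<Sum>r\<in>V. \<Sum>t\<in>V. \<Sum>q\<in>V. f s r t q) = (\<Sum>q\<in>V. \<Sum>s\<in>V. \<Sum>r\<in>V. \<Sum>t\<in>V. f s r t q)"
proof -
  have 1: "(\<Sum>t\<in>V. \<Sum>q\<in>V. f s r t q) = (\<Sum>q\<in>V. \<Sum>t\<in>V. f s r t q)" for s r by (rule sum.swap)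
  have 2: "(\<Sum>r\<in>V. \<Sum>q\<in>V. \<Sum>t\<in>V. f s r t q) = (\<Sum>q\<in>V. \<Sum>r\<in>V. \<Sum>t\<in>V. f s r t q)" for s
    by (rule sum.swap)
  show ?thesis unfolding 1 2 by (rule sum.swap)
qed

context density_graph begin

lemma D3_sum: "D 3 a b * real (card V) ^ 3 = (\<Sum>p\<in>V. \<Sum>s\<in>V. \<Sum>r\<in>V. A a p * (A p r * A r s) * A s b)"
proof -
  have "D 3 a b = avg (\<lambda>p. avg (\<lambda>s. avg (\<lambda>r. A a p * (A p r * A r s) * A s b)))"
    by (simp only: D3_eq[symmetric] codeg_def avg_mult_left avg_mult_right)
  also have "\<dots> = (\<Sum>p\<in>V. \<Sum>s\<in>V. \<Sum>r\<in>V. A a p * (A p r * A r s) * A s b) / real (card V) ^ 3"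
    by (simp only: avg_def sum_divide_distrib[symmetric] divide_divide_eq_left power3_eq_cube mult.assoc)
  finally show ?thesis using card_pos by simp
qed

lemma D5_sum:
  "D 5 a b * real (card V) ^ 5 =
    (\<Sum>p\<in>V. \<Sum>s\<in>V. \<Sum>r\<in>V. \<Sum>t\<in>V. \<Sum>q\<in>V. A a p * (A p r * (A r q * A q t) * A t s) * A s b)"
proof -
  have "D 5 a b = avg (\<lambda>p. avg (\<lambda>s. A a p * D 3 p s * A s b))"
    using D_Suc_Suc[of 3 a b] by (simp add: eval_nat_numeral)
  also have "\<dots> = avg (\<lambda>p. avg (\<lambda>s. avg (\<lambda>r. avg (\<lambda>t. avg (\<lambda>q.
      A a p * (A p r * (A r q * A q t) * A t s) * A s b)))))"
    by (simp only: D3_eq[symmetric] codeg_def avg_mult_left avg_mult_right)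
  also have "\<dots> = (\<Sum>p\<in>V. \<Sum>s\<in>V. \<Sum>r\<in>V. \<Sum>t\<in>V. \<Sum>q\<in>V.
      A a p * (A p r * (A r q * A q t) * A t s) * A s b) / real (card V) ^ 5"
    by (simp only: avg_def sum_divide_distrib[symmetric] divide_divide_eq_left)
      (simp add: eval_nat_numeral mult_ac)
  finally show ?thesis using card_pos by simp
qed

end

section \<open>Maps from H that send the critical edge to a given edge\<close>

locale host_graph = pair_graph G for G :: "'v pair_pre_digraph" +
  fixes \<alpha> :: real
  assumes verts_ne: "pverts G \<noteq> {}" and \<alpha>_pos: "\<alpha> > 0"
    and min_degree: "v \<in> pverts G \<Longrightarrow> (1 / 4 + \<alpha>) * real (card (pverts G)) \<le> real (out_degree G v)"
begin

abbreviation "V \<equiv> pverts G"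

sublocale dg: density_graph V "\<lambda>x y. of_bool ((x, y) \<in> parcs G)" \<alpha>
proof
  fix x
  assume x: "x \<in> V"
  have "out_arcs G x = Pair x ` {y \<in> V. (x, y) \<in> parcs G}"
    using in_arcsD2 by (auto simp: out_arcs_def)
  then have "out_degree G x = card {y \<in> V. (x, y) \<in> parcs G}"
    by (simp add: out_degree_def card_image inj_on_def)
  then show "(1 / 4 + \<alpha>) * real (card V) \<le> (\<Sum>y\<in>V. of_bool ((x, y) \<in> parcs G))"
    using min_degree[OF x] by (simp add: Int_def)
next
  fix x y
  show "of_bool ((x, y) \<in> parcs G) = (of_bool ((y, x) \<in> parcs G) :: real)"
    using arcs_symmetric by auto
qed (use pair_finite_verts verts_ne \<alpha>_pos in auto)

text \<open>The interior vertices are grouped by the parity of their position, 1 and 3 in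
  \<open>p\<close> and 2 in \<open>r\<close>: walks become incidences of a bipartite
  relation.\<close>

lemma walks4_count:
  "dg.D 3 a b * real (card (V \<times> V) * card V) = real (card {(p, r). p \<in> V \<times> V \<and> r \<in> V \<and>
    (a, fst p) \<in> parcs G \<and> (fst p, r) \<in> parcs G \<and> (r, snd p) \<in> parcs G \<and> (snd p, b) \<in> parcs G})"
proof -
  have "dg.D 3 a b * real (card (V \<times> V) * card V) = (\<Sum>p\<in>V. \<Sum>s\<in>V. \<Sum>r\<in>V. of_bool
    ((a, p) \<in> parcs G \<and> (p, r) \<in> parcs G \<and> (r, s) \<in> parcs G \<and> (s, b) \<in> parcs G))"
    using dg.D3_sum[of a b]
    by (simp add: card_cartesian_product power3_eq_cube mult_ac of_bool_conj del: sum_of_bool_eq sum_of_bool_mult_eq sum_mult_of_bool_eq)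
  also have "\<dots> = real (card {(p, r). p \<in> V \<times> V \<and> r \<in> V \<and>
    (a, fst p) \<in> parcs G \<and> (fst p, r) \<in> parcs G \<and> (r, snd p) \<in> parcs G \<and> (snd p, b) \<in> parcs G})"
    by (subst card_rel_of_bool) (simp_all add: dg.fin sum.cartesian_product')
  finally show ?thesis .
qed

lemma walks6_count:
  "dg.D 5 a b * real (card (V \<times> V \<times> V) * card (V \<times> V)) =
    real (card {(p, r). p \<in> V \<times> V \<times> V \<and> r \<in> V \<times> V \<and>
      (a, fst p) \<in> parcs G \<and> (fst p, fst r) \<in> parcs G \<and> (fst r, fst (snd p)) \<in> parcs G \<and>
      (fst (snd p), snd r) \<in> parcs G \<and> (snd r, snd (snd p)) \<in> parcs G \<and> (snd (snd p), b) \<in> parcs G})"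
proof -
  have "dg.D 5 a b * real (card (V \<times> V \<times> V) * card (V \<times> V)) = (\<Sum>p\<in>V. \<Sum>s\<in>V. \<Sum>r\<in>V. \<Sum>t\<in>V. \<Sum>q\<in>V. of_bool
    ((a, p) \<in> parcs G \<and> (p, r) \<in> parcs G \<and> (r, q) \<in> parcs G \<and> (q, t) \<in> parcs G \<and> (t, s) \<in> parcs G \<and> (s, b) \<in> parcs G))"
    using dg.D5_sum[of a b]
    by (simp add: card_cartesian_product eval_nat_numeral mult_ac of_bool_conj del: sum_of_bool_eq sum_of_bool_mult_eq sum_mult_of_bool_eq)
  also have "\<dots> = (\<Sum>p\<in>V. \<Sum>q\<in>V. \<Sum>s\<in>V. \<Sum>r\<in>V. \<Sum>t\<in>V. of_bool
    ((a, p) \<in> parcs G \<and> (p, r) \<in> parcs G \<and> (r, q) \<in> parcs G \<and> (q, t) \<in> parcs G \<and> (t, s) \<in> parcs G \<and> (s, b) \<in> parcs G))"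
    by (rule sum.cong[OF refl], rule sum_rotate4)
  also have "\<dots> = real (card {(p, r). p \<in> V \<times> V \<times> V \<and> r \<in> V \<times> V \<and>
      (a, fst p) \<in> parcs G \<and> (fst p, fst r) \<in> parcs G \<and> (fst r, fst (snd p)) \<in> parcs G \<and>
      (fst (snd p), snd r) \<in> parcs G \<and> (snd r, snd (snd p)) \<in> parcs G \<and> (snd (snd p), b) \<in> parcs G})"
    by (subst card_rel_of_bool) (simp_all add: dg.fin sum.cartesian_product')
  finally show ?thesis .
qed

end

text \<open>
  A path pattern exhibits \<open>H\<close> minus the edge \<open>xy\<close> inside a blow-up of a path with \<open>m\<close> edges
  whose two end vertices, the images of \<open>x\<close> and \<open>y\<close>, are not blown up.
\<close>

definition path_pattern :: "'a pair_pre_digraph \<Rightarrow> 'a \<Rightarrow> 'a \<Rightarrow> nat \<Rightarrow> ('a \<Rightarrow> nat) \<Rightarrow> bool" where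
  "path_pattern H x y m \<psi> \<longleftrightarrow> \<psi> x = 0 \<and> \<psi> y = m \<and>
     (\<forall>u \<in> pverts H - {x, y}. 0 < \<psi> u \<and> \<psi> u < m) \<and>
     (\<forall>(u, w) \<in> parcs H - {(x, y), (y, x)}. \<psi> w = Suc (\<psi> u) \<or> \<psi> u = Suc (\<psi> w))"

context host_graph begin

definition edge_homs :: "'a pair_pre_digraph \<Rightarrow> 'a \<Rightarrow> 'a \<Rightarrow> 'v \<Rightarrow> 'v \<Rightarrow> ('a \<Rightarrow> 'v) set" where
  "edge_homs H x y a b = {f \<in> (pverts H - {x, y}) \<rightarrow>\<^sub>E V.
     \<forall>(u, w) \<in> parcs H. ((f(x := a, y := b)) u, (f(x := a, y := b)) w) \<in> parcs G}"

lemma path_pattern_hom: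
  assumes "pair_graph H" "(x, y) \<in> parcs H" "(a, b) \<in> parcs G" and pat: "path_pattern H x y m \<psi>"
    and up: "\<And>u w. u \<in> pverts H \<Longrightarrow> w \<in> pverts H \<Longrightarrow> \<psi> w = Suc (\<psi> u) \<Longrightarrow> (e u, e w) \<in> parcs G"
    and e: "e x = a" "e y = b"
  shows "\<forall>(u, w) \<in> parcs H. (e u, e w) \<in> parcs G"
proof clarify
  fix u w assume uw: "(u, w) \<in> parcs H"
  interpret H: pair_graph H by fact
  have V: "u \<in> pverts H" "w \<in> pverts H" using uw H.in_arcsD1 H.in_arcsD2 by auto
  consider "(u, w) = (x, y)" | "(u, w) = (y, x)" | "\<psi> w = Suc (\<psi> u)" | "\<psi> u = Suc (\<psi> w)"
    using pat uw unfolding path_pattern_def by blast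
  then show "(e u, e w) \<in> parcs G"
  proof cases
    case 1 then show ?thesis using assms e by auto
  next
    case 2 then show ?thesis using assms e arcs_symmetric by auto
  next
    case 3 then show ?thesis using up V by auto
  next
    case 4 then show ?thesis using up V arcs_symmetric by auto
  qed
qed

text \<open>Adjacent vertices of \<open>H\<close> outside \<open>x\<close>, \<open>y\<close> have
  positions of different parity, so one takes its image from its \<open>X\<close> part and the other
  from its \<open>Y\<close> part. The relation \<open>M\<close> between the parts of different
  vertices, as in \<open>complete_bipartite_count\<close>, supplies the required edge.\<close>

lemma edge_homs_pattern4:
  assumes H: "pair_graph H" "(x, y) \<in> parcs H" and ab: "(a, b) \<in> parcs G"
    and pat: "path_pattern H x y 4 \<psi>" and \<eta>: "0 \<le> \<eta>" "\<eta> \<le> dg.D 3 a b"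
    and t: "t = card (pverts H - {x, y})"
  shows "\<eta> ^ (t * t) * real (card V) ^ t \<le> real (card (edge_homs H x y a b))"
  unfolding edge_homs_def t
proof (rule hom_count[where X = "V \<times> V" and Y = V and
      \<kappa> = "\<lambda>u q. if \<psi> u = 1 then fst (fst q) else if \<psi> u = 2 then snd q else snd (fst q)" and
      M = "\<lambda>p r. (a, fst p) \<in> parcs G \<and> (fst p, r) \<in> parcs G \<and> (r, snd p) \<in> parcs G \<and> (snd p, b) \<in> parcs G"])
  interpret H: pair_graph H by fact
  let ?U = "pverts H - {x, y}"
  have xy: "x \<noteq> y" using H(2) H.no_loops' by auto
  show "finite ?U" using H.pair_finite_verts by auto
  show "\<eta> * real (card (V \<times> V) * card V) \<le> real (card {(p, r). p \<in> V \<times> V \<and> r \<in> V \<and>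
    (a, fst p) \<in> parcs G \<and> (fst p, r) \<in> parcs G \<and> (r, snd p) \<in> parcs G \<and> (snd p, b) \<in> parcs G})"
    unfolding walks4_count[symmetric] using \<eta> by (intro mult_right_mono) auto
  show "card {q \<in> (V \<times> V) \<times> V. (if \<psi> u = 1 then fst (fst q) else if \<psi> u = 2 then snd q else snd (fst q)) = v} * card V
      = card (V \<times> V) * card V" if "v \<in> V" for u v
  proof -
    have "{q \<in> (V \<times> V) \<times> V. fst (fst q) = v} = ({v} \<times> V) \<times> V"
      "{q \<in> (V \<times> V) \<times> V. snd (fst q) = v} = (V \<times> {v}) \<times> V"
      "{q \<in> (V \<times> V) \<times> V. snd q = v} = (V \<times> V) \<times> {v}" using that by auto
    then show ?thesis
      by (cases "\<psi> u = 1"; cases "\<psi> u = 2") (simp_all add: card_cartesian_product)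
  qed
  fix q assume q: "q \<in> ?U \<rightarrow>\<^sub>E (V \<times> V) \<times> V"
    and M: "\<And>u u'. u \<in> ?U \<Longrightarrow> u' \<in> ?U \<Longrightarrow> (a, fst (fst (q u))) \<in> parcs G \<and>
      (fst (fst (q u)), snd (q u')) \<in> parcs G \<and> (snd (q u'), snd (fst (q u))) \<in> parcs G \<and>
      (snd (fst (q u)), b) \<in> parcs G"
  define e where "e = (\<lambda>u\<in>?U. if \<psi> u = 1 then fst (fst (q u)) else if \<psi> u = 2 then snd (q u) else snd (fst (q u)))
    (x := a, y := b)"
  have "(e u, e w) \<in> parcs G" if uw: "u \<in> pverts H" "w \<in> pverts H" "\<psi> w = Suc (\<psi> u)" for u w
  proof -
    have eu: "z \<in> ?U \<and> 0 < \<psi> z \<and> \<psi> z < 4 \<and>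
        e z = (if \<psi> z = 1 then fst (fst (q z)) else if \<psi> z = 2 then snd (q z) else snd (fst (q z)))
        \<or> \<psi> z = 0 \<and> e z = a \<or> \<psi> z = 4 \<and> e z = b" if "z \<in> pverts H" for z
      using pat that xy unfolding path_pattern_def e_def by auto
    have "\<psi> u = 0 \<or> \<psi> u = 1 \<or> \<psi> u = 2 \<or> \<psi> u = 3" using eu[OF uw(1)] eu[OF uw(2)] uw(3) by auto
    then show ?thesis
      using eu[OF uw(1)] eu[OF uw(2)] uw(3) M[of u w] M[of w u] M[of u u] M[of w w] by auto
  qed
  then have "\<forall>(u, w) \<in> parcs H. (e u, e w) \<in> parcs G"
    by (rule path_pattern_hom[OF H ab pat]) (use xy in \<open>auto simp: e_def\<close>)
  then show "\<forall>(u, w) \<in> parcs H. (((\<lambda>u\<in>?U. if \<psi> u = 1 then fst (fst (q u)) else if \<psi> u = 2 then snd (q u) else snd (fst (q u)))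
    (x := a, y := b)) u, ((\<lambda>u\<in>?U. if \<psi> u = 1 then fst (fst (q u)) else if \<psi> u = 2 then snd (q u) else snd (fst (q u)))
    (x := a, y := b)) w) \<in> parcs G"
    by (simp add: e_def)
qed (use \<eta> dg.fin dg.ne in auto)

lemma edge_homs_pattern6:
  assumes H: "pair_graph H" "(x, y) \<in> parcs H" and ab: "(a, b) \<in> parcs G"
    and pat: "path_pattern H x y 6 \<psi>" and \<eta>: "0 \<le> \<eta>" "\<eta> \<le> dg.D 5 a b"
    and t: "t = card (pverts H - {x, y})"
  shows "\<eta> ^ (t * t) * real (card V) ^ t \<le> real (card (edge_homs H x y a b))"
proof -
  interpret H: pair_graph H by fact
  let ?U = "pverts H - {x, y}"
  \<comment> \<open>Odd positions are read from the first factor, even ones from the second.\<close>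
  define pos where "pos i q = (if i = 1 then fst (fst q) else if i = 2 then fst (snd q)
      else if i = 3 then fst (snd (fst q)) else if i = 4 then snd (snd q) else snd (snd (fst q)))"
    for i :: nat and q :: "('v \<times> 'v \<times> 'v) \<times> 'v \<times> 'v"
  have xy: "x \<noteq> y" using H(2) H.no_loops' by auto
  show ?thesis
    unfolding edge_homs_def t
  proof (rule hom_count[where X = "V \<times> V \<times> V" and Y = "V \<times> V" and \<kappa> = "\<lambda>u. pos (\<psi> u)" and
      M = "\<lambda>p r. (a, fst p) \<in> parcs G \<and> (fst p, fst r) \<in> parcs G \<and> (fst r, fst (snd p)) \<in> parcs G \<and>
      (fst (snd p), snd r) \<in> parcs G \<and> (snd r, snd (snd p)) \<in> parcs G \<and> (snd (snd p), b) \<in> parcs G"])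
    show "finite ?U" using H.pair_finite_verts by auto
    show "\<eta> * real (card (V \<times> V \<times> V) * card (V \<times> V)) \<le> real (card {(p, r). p \<in> V \<times> V \<times> V \<and> r \<in> V \<times> V \<and>
      (a, fst p) \<in> parcs G \<and> (fst p, fst r) \<in> parcs G \<and> (fst r, fst (snd p)) \<in> parcs G \<and>
      (fst (snd p), snd r) \<in> parcs G \<and> (snd r, snd (snd p)) \<in> parcs G \<and> (snd (snd p), b) \<in> parcs G})"
      unfolding walks6_count[symmetric] using \<eta> by (intro mult_right_mono) auto
    show "card {q \<in> (V \<times> V \<times> V) \<times> V \<times> V. pos (\<psi> u) q = v} * card V
      = card (V \<times> V \<times> V) * card (V \<times> V)" if "v \<in> V" for u v
    proof -
      have "{q \<in> (V \<times> V \<times> V) \<times> V \<times> V. fst (fst q) = v} = ({v} \<times> V \<times> V) \<times> V \<times> V"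
        "{q \<in> (V \<times> V \<times> V) \<times> V \<times> V. fst (snd (fst q)) = v} = (V \<times> {v} \<times> V) \<times> V \<times> V"
        "{q \<in> (V \<times> V \<times> V) \<times> V \<times> V. snd (snd (fst q)) = v} = (V \<times> V \<times> {v}) \<times> V \<times> V"
        "{q \<in> (V \<times> V \<times> V) \<times> V \<times> V. fst (snd q) = v} = (V \<times> V \<times> V) \<times> {v} \<times> V"
        "{q \<in> (V \<times> V \<times> V) \<times> V \<times> V. snd (snd q) = v} = (V \<times> V \<times> V) \<times> V \<times> {v}" using that by auto
      then show ?thesis unfolding pos_def
        by (cases "\<psi> u = 1"; cases "\<psi> u = 2"; cases "\<psi> u = 3"; cases "\<psi> u = 4")
          (simp_all add: card_cartesian_product)
    qed
    show "pos (\<psi> u) q \<in> V" if "q \<in> (V \<times> V \<times> V) \<times> V \<times> V" for u q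
      using that by (auto simp: pos_def)
    fix q assume q: "q \<in> ?U \<rightarrow>\<^sub>E (V \<times> V \<times> V) \<times> V \<times> V"
      and M: "\<And>u u'. u \<in> ?U \<Longrightarrow> u' \<in> ?U \<Longrightarrow> (a, fst (fst (q u))) \<in> parcs G \<and>
        (fst (fst (q u)), fst (snd (q u'))) \<in> parcs G \<and> (fst (snd (q u')), fst (snd (fst (q u)))) \<in> parcs G \<and>
        (fst (snd (fst (q u))), snd (snd (q u'))) \<in> parcs G \<and>
        (snd (snd (q u')), snd (snd (fst (q u)))) \<in> parcs G \<and> (snd (snd (fst (q u))), b) \<in> parcs G"
    define e where "e = (\<lambda>u\<in>?U. pos (\<psi> u) (q u))(x := a, y := b)"
    have "(e u, e w) \<in> parcs G" if uw: "u \<in> pverts H" "w \<in> pverts H" "\<psi> w = Suc (\<psi> u)" for u w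
    proof -
      have eu: "z \<in> ?U \<and> 0 < \<psi> z \<and> \<psi> z < 6 \<and> e z = pos (\<psi> z) (q z)
        \<or> \<psi> z = 0 \<and> e z = a \<or> \<psi> z = 6 \<and> e z = b" if "z \<in> pverts H" for z
        using pat that xy unfolding path_pattern_def e_def by auto
      have "\<psi> u = 0 \<or> \<psi> u = 1 \<or> \<psi> u = 2 \<or> \<psi> u = 3 \<or> \<psi> u = 4 \<or> \<psi> u = 5"
        using eu[OF uw(1)] eu[OF uw(2)] uw(3) by auto
      then show ?thesis
        using eu[OF uw(1)] eu[OF uw(2)] uw(3) M[of u w] M[of w u] M[of u u] M[of w w]
        unfolding pos_def by (elim disjE) auto
    qed
    then have "\<forall>(u, w) \<in> parcs H. (e u, e w) \<in> parcs G"
      by (rule path_pattern_hom[OF H ab pat]) (use xy in \<open>auto simp: e_def\<close>)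
    then show "\<forall>(u, w) \<in> parcs H. (((\<lambda>u\<in>?U. pos (\<psi> u) (q u))(x := a, y := b)) u,
        ((\<lambda>u\<in>?U. pos (\<psi> u) (q u))(x := a, y := b)) w) \<in> parcs G"
      by (simp add: e_def)
  qed (use \<eta> dg.fin dg.ne in auto)
qed

end

section \<open>Graphs with a critical edge\<close>

lemma chromatic_number_le: "proper_colouring G k c \<Longrightarrow> chromatic_number G \<le> k"
  unfolding chromatic_number_def by (rule Least_le) blast

text \<open>An injection into an initial segment of the naturals is a colouring, so the least number
  in \<open>chromatic_number\<close> is attained.\<close>

lemma chromatic_number_colouring:
  assumes "finite (pverts G)" "\<And>u w. (u, w) \<in> parcs G \<Longrightarrow> u \<in> pverts G \<and> w \<in> pverts G \<and> u \<noteq> w"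
  shows "\<exists>c. proper_colouring G (chromatic_number G) c"
proof -
  obtain c :: "'a \<Rightarrow> nat" and k where c: "c ` pverts G = {i. i < k}" "inj_on c (pverts G)"
    using finite_imp_inj_to_nat_seg[OF assms(1)] by blast
  have "proper_colouring G k c"
    unfolding proper_colouring_def
  proof (intro conjI)
    show "\<forall>(x, y)\<in>parcs G. c x \<noteq> c y"
    proof clarify
      fix x y assume "(x, y) \<in> parcs G" "c x = c y"
      then show False using assms(2)[of x y] inj_onD[OF c(2), of x y] by simp
    qed
    show "c ` pverts G \<subseteq> {..<k}" using c(1) by (simp add: lessThan_def)
  qed
  then have "\<exists>k c. proper_colouring G k c" by blast
  then show ?thesis unfolding chromatic_number_def
    by (rule LeastI_ex[where P = "\<lambda>k. \<exists>c. proper_colouring G k c"])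
qed

locale critical_graph = pair_graph H for H :: "'a pair_pre_digraph" +
  fixes x y :: 'a and c :: "'a \<Rightarrow> nat"
  assumes xy: "(x, y) \<in> parcs H"
    and col: "proper_colouring (del_edge H x y) 2 c"
    and chi: "chromatic_number H = 3"
    and no_triangle: "(x, u) \<in> parcs H \<Longrightarrow> (u, y) \<in> parcs H \<Longrightarrow> False"
begin

lemma sym: "(u, w) \<in> parcs H \<Longrightarrow> (w, u) \<in> parcs H"
  using arcs_symmetric by blast

lemma x_neq_y: "x \<noteq> y" using xy no_loops' by auto

lemma xyV: "x \<in> pverts H" "y \<in> pverts H" using xy in_arcsD1 in_arcsD2 by auto

lemma c_less: "u \<in> pverts H \<Longrightarrow> c u < 2"
  using col unfolding proper_colouring_def del_edge_def by (simp add: image_subset_iff)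

lemma c_arc: "(u, w) \<in> parcs H \<Longrightarrow> (u, w) \<noteq> (x, y) \<Longrightarrow> (u, w) \<noteq> (y, x) \<Longrightarrow> c u \<noteq> c w"
  using col unfolding proper_colouring_def del_edge_def by force

lemma no_2_colouring: "\<not> proper_colouring H 2 d"
  using chromatic_number_le[of H 2 d] chi by auto

lemma c_xy: "c x = c y"
proof (rule ccontr)
  assume n: "c x \<noteq> c y"
  have arc: "c u \<noteq> c w" if uw: "(u, w) \<in> parcs H" for u w
  proof -
    consider "u = x" "w = y" | "u = y" "w = x" | "(u, w) \<noteq> (x, y)" "(u, w) \<noteq> (y, x)" by blast
    then show ?thesis
    proof cases
      case 3 then show ?thesis using c_arc[OF uw] by blast
    qed (use n in simp_all)
  qed
  have "proper_colouring H 2 c" unfolding proper_colouring_def using c_less arc by blast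
  then show False using no_2_colouring by blast
qed

lemma two_colours:
  assumes "u \<in> pverts H" "w \<in> pverts H" "c u \<noteq> c x" "c w \<noteq> c x"
  shows "c u = c w"
proof -
  have "c u < 2" "c w < 2" "c x < 2" using assms xyV(1) by (auto intro: c_less)
  then show ?thesis using assms(3,4) by presburger
qed

lemma pattern_sym:
  assumes "\<And>u w. (u, w) \<in> parcs H - {(x, y), (y, x)} \<Longrightarrow> c u = c x \<Longrightarrow> c w \<noteq> c x \<Longrightarrow>
    \<psi> w = Suc (\<psi> u) \<or> \<psi> u = Suc (\<psi> w)"
  shows "\<forall>(u, w) \<in> parcs H - {(x, y), (y, x)}. \<psi> w = Suc (\<psi> u) \<or> \<psi> u = Suc (\<psi> w)"
proof -
  have "\<psi> w = Suc (\<psi> u) \<or> \<psi> u = Suc (\<psi> w)" if a: "(u, w) \<in> parcs H - {(x, y), (y, x)}" for u w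
  proof -
    have V: "u \<in> pverts H" "w \<in> pverts H" using a in_arcsD1[of u w] in_arcsD2[of u w] by simp_all
    have ne: "c u \<noteq> c w" using a c_arc[of u w] by simp
    show ?thesis
    proof (cases "c u = c x")
      case True then show ?thesis using assms[OF a] ne by metis
    next
      case False
      then have "c w = c x" using two_colours[OF V] ne by metis
      moreover have "(w, u) \<in> parcs H - {(x, y), (y, x)}" using a sym[of u w] by auto
      ultimately show ?thesis using assms[of w u] False by blast
    qed
  qed
  then show ?thesis by blast
qed

lemma arc_cases:
  assumes "(u, w) \<in> parcs H - {(x, y), (y, x)}" "c u = c x" "c w \<noteq> c x"
  shows "u \<noteq> w" "w \<noteq> x" "w \<noteq> y" "(u, w) \<in> parcs H" "(w, u) \<in> parcs H" "u \<in> pverts H" "w \<in> pverts H"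
  using assms c_xy sym[of u w] in_arcsD1[of u w] in_arcsD2[of u w] by auto

text \<open>In the 2-colouring of \<open>H - xy\<close>, the colour class of \<open>x\<close> and
  \<open>y\<close> gets even positions. Neighbours of \<open>y\<close> have to be at 3 and those of
  \<open>x\<close> at 1; these demands are compatible because \<open>xy\<close> lies in no
  triangle.\<close>

definition pattern4 :: "'a \<Rightarrow> nat" where
  "pattern4 u = (if u = x then 0 else if u = y then 4 else if c u = c x then 2
     else if (u, y) \<in> parcs H then 3 else 1)"

lemma path_pattern4: "path_pattern H x y 4 pattern4"
  unfolding path_pattern_def
proof (intro conjI pattern_sym)
  fix u w assume a: "(u, w) \<in> parcs H - {(x, y), (y, x)}" "c u = c x" "c w \<noteq> c x"
  note b = arc_cases[OF a]
  have w: "pattern4 w = (if (w, y) \<in> parcs H then 3 else 1)"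
    using b a(3) by (simp add: pattern4_def)
  consider "u = x" | "u = y" | "u \<noteq> x" "u \<noteq> y" by blast
  then show "pattern4 w = Suc (pattern4 u) \<or> pattern4 u = Suc (pattern4 w)"
  proof cases
    case 1
    then have "(w, y) \<notin> parcs H" using no_triangle[of w] b by blast
    then show ?thesis using 1 w by (simp add: pattern4_def)
  next
    case 2
    then show ?thesis using b w x_neq_y by (simp add: pattern4_def)
  next
    case 3
    then show ?thesis using w a(2) by (simp add: pattern4_def)
  qed
qed (simp_all add: pattern4_def x_neq_y x_neq_y[symmetric])

text \<open>A vertex next to a neighbour of \<open>y\<close> has to be at 4, one next to a neighbour
  of \<open>x\<close> at 2. Both at once would put it in the middle of a path of length 4 from
  \<open>x\<close> to \<open>y\<close>, that is, in a 5-cycle through \<open>xy\<close>.\<close>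

definition pattern6 :: "'a \<Rightarrow> nat" where
  "pattern6 u = (if u = x then 0 else if u = y then 6
     else if c u = c x then (if \<exists>t. (u, t) \<in> parcs H \<and> (t, y) \<in> parcs H then 4 else 2)
     else if (u, y) \<in> parcs H then 5 else if (x, u) \<in> parcs H then 1 else 3)"

lemma path_pattern6:
  assumes no_pentagon: "\<And>u m t. (x, u) \<in> parcs H \<Longrightarrow> (u, m) \<in> parcs H \<Longrightarrow> (m, t) \<in> parcs H \<Longrightarrow>
    (t, y) \<in> parcs H \<Longrightarrow> m = x \<or> m = y"
  shows "path_pattern H x y 6 pattern6"
  unfolding path_pattern_def
proof (intro conjI pattern_sym)
  fix u w assume a: "(u, w) \<in> parcs H - {(x, y), (y, x)}" "c u = c x" "c w \<noteq> c x"
  note b = arc_cases[OF a]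
  show "pattern6 w = Suc (pattern6 u) \<or> pattern6 u = Suc (pattern6 w)"
  proof (cases "u = x \<or> u = y")
    case True
    have w: "pattern6 w = (if (w, y) \<in> parcs H then 5 else if (x, w) \<in> parcs H then 1 else 3)"
      using b a(3) by (simp add: pattern6_def)
    from True show ?thesis
    proof
      assume u: "u = x"
      then have "(w, y) \<notin> parcs H" using no_triangle[of w] b by blast
      then show ?thesis using u b w by (simp add: pattern6_def)
    next
      assume u: "u = y"
      then show ?thesis using b w x_neq_y by (simp add: pattern6_def)
    qed
  next
    case False
    define K where "K \<longleftrightarrow> (\<exists>t. (u, t) \<in> parcs H \<and> (t, y) \<in> parcs H)"
    have u: "pattern6 u = (if K then 4 else 2)"
      using False a(2) by (simp add: pattern6_def K_def)
    have w: "pattern6 w = (if (w, y) \<in> parcs H then 5 else if (x, w) \<in> parcs H then 1 else 3)"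
      using b a(3) by (simp add: pattern6_def)
    have "(w, y) \<in> parcs H \<Longrightarrow> K" using b unfolding K_def by blast
    moreover have "(x, w) \<in> parcs H \<Longrightarrow> \<not> K"
      using b no_pentagon[of w u] False unfolding K_def by blast
    ultimately show ?thesis unfolding u w by simp
  qed
qed (simp_all add: pattern6_def x_neq_y x_neq_y[symmetric])

text \<open>If \<open>H - xy\<close> had no walk from \<open>x\<close> to \<open>y\<close>, swapping
  the colours in the component of \<open>x\<close> would give a 2-colouring of \<open>H\<close>. The
  length is even because \<open>x\<close> and \<open>y\<close> have the same colour, so the edge
  \<open>yx\<close> closes an odd walk.\<close>

lemma even_walk:
  obtains f l where "f 0 = x" "f (2 * l + 2) = y" "\<And>i. i < 2 * l + 2 \<Longrightarrow> (f i, f (Suc i)) \<in> parcs H"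
proof -
  define R where "R = parcs (del_edge H x y)"
  have R: "R = parcs H - {(x, y), (y, x)}" by (simp add: R_def del_edge_def)
  have symR: "(u, w) \<in> R \<Longrightarrow> (w, u) \<in> R" for u w
    using sym[of u w] by (auto simp: R)
  have "(x, y) \<in> R\<^sup>*"
  proof (rule ccontr)
    assume n: "(x, y) \<notin> R\<^sup>*"
    define d where "d v = (if (x, v) \<in> R\<^sup>* then 1 - c v else c v)" for v
    have dl: "d v < 2" if "v \<in> pverts H" for v
      using c_less[OF that] diff_le_self[of 1 "c v"] unfolding d_def by presburger
    have da: "d u \<noteq> d w" if uw: "(u, w) \<in> parcs H" for u w
    proof (cases "(u, w) \<in> R")
      case True
      have "(x, u) \<in> R\<^sup>* \<longleftrightarrow> (x, w) \<in> R\<^sup>*"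
        using rtrancl_into_rtrancl[of x u R w] rtrancl_into_rtrancl[of x w R u] True symR[OF True]
        by blast
      moreover have "c u \<noteq> c w" using True c_arc[of u w] by (simp add: R)
      moreover have "c u < 2" "c w < 2"
        using c_less[of u] c_less[of w] in_arcsD1[OF uw] in_arcsD2[OF uw] by simp_all
      ultimately show ?thesis unfolding d_def by presburger
    next
      case False
      then have "u = x \<and> w = y \<or> u = y \<and> w = x" using uw by (simp add: R)
      moreover have "d x = 1 - c x" "d y = c x" using n c_xy by (simp_all add: d_def)
      then have "d x \<noteq> d y" using c_less[OF xyV(1)] by presburger
      ultimately show ?thesis by metis
    qed
    have "proper_colouring H 2 d" unfolding proper_colouring_def using dl da by blast
    then show False using no_2_colouring by blast
  qed
  then obtain n where "(x, y) \<in> R ^^ n" using rtrancl_imp_relpow by blast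
  then obtain f where f: "f 0 = x" "f n = y" "\<And>i. i < n \<Longrightarrow> (f i, f (Suc i)) \<in> R"
    unfolding relpow_fun_conv by blast
  have parity: "c (f i) = c x \<longleftrightarrow> even i" if "i \<le> n" for i
    using that
  proof (induction i)
    case (Suc i)
    have "(f i, f (Suc i)) \<in> R" using Suc.prems f(3)[of i] by simp
    then have "c (f i) \<noteq> c (f (Suc i))" "f i \<in> pverts H" "f (Suc i) \<in> pverts H"
      using c_arc[of "f i" "f (Suc i)"] in_arcsD1[of "f i" "f (Suc i)"] in_arcsD2[of "f i" "f (Suc i)"]
      by (simp_all add: R)
    moreover have "c (f i) = c x \<longleftrightarrow> even i" using Suc by simp
    ultimately show ?case using two_colours[of "f i" "f (Suc i)"] by (metis even_Suc)
  qed (simp add: f)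
  have "even n" using parity[of n] f(2) c_xy by simp
  moreover have "n \<noteq> 0" using f(1,2) x_neq_y by (cases n) simp_all
  ultimately obtain k where "n = 2 * k" "k \<noteq> 0" by (metis evenE mult_0_right)
  then obtain l where "n = 2 * l + 2" by (cases k) auto
  moreover have "(f i, f (Suc i)) \<in> parcs H" if "i < n" for i using f(3)[OF that] by (simp add: R)
  ultimately show ?thesis using that[of f l] f(1,2) by blast
qed

end

lemma critical_graph_exists:
  assumes "pair_graph H" "chromatic_number H = 3" "critical_edge H x y" "odd_girth H \<ge> 5"
  shows "\<exists>c. critical_graph H x y c"
proof -
  interpret pair_graph H by fact
  have xy: "(x, y) \<in> parcs H" and less: "chromatic_number (del_edge H x y) < 3"
    using assms by (auto simp: critical_edge_def)
  have "\<exists>c. proper_colouring (del_edge H x y) (chromatic_number (del_edge H x y)) c"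
    using pair_finite_verts in_arcsD1 in_arcsD2 no_loops'
    by (intro chromatic_number_colouring) (auto simp: del_edge_def)
  then obtain c where "proper_colouring (del_edge H x y) (chromatic_number (del_edge H x y)) c" ..
  then have col: "proper_colouring (del_edge H x y) 2 c"
    using less unfolding proper_colouring_def by (force simp: subset_iff)
  have tri: False if u: "(x, u) \<in> parcs H" "(u, y) \<in> parcs H" for u
  proof -
    have yx: "(y, x) \<in> parcs H" using xy arcs_symmetric by blast
    have "x \<noteq> y" "x \<noteq> u" "u \<noteq> y" "x \<in> pverts H" "y \<in> pverts H" "u \<in> pverts H"
      using xy u no_loops' in_arcsD1 in_arcsD2 by auto
    then have "cycle [(x, u), (u, y), (y, x)]"
      using u yx unfolding cycle_def by (auto simp: awalk_def intro!: exI[of _ x])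
    then have "odd_girth H \<le> enat (length [(x, u), (u, y), (y, x)])"
      unfolding odd_girth_def by (intro INF_lower) auto
    then have "odd_girth H \<le> 3" by (simp add: numeral_eq_enat eval_nat_numeral)
    then have "(5::enat) \<le> 3" using assms(4) by (rule order.trans[rotated])
    then show False by simp
  qed
  have "critical_graph H x y c"
    by unfold_locales (use xy col assms tri in auto)
  then show ?thesis by blast
qed

section \<open>Robust edges\<close>

context host_graph begin

text \<open>Arcs in \<open>Rob\<close> contribute at most their own density, the others at most
  \<open>\<xi>\<close>.\<close>

lemma avg_arcs_le:
  assumes Rob: "Rob \<subseteq> parcs G" and few: "real (card Rob) \<le> \<xi> * real (card V) ^ 2"
    and f: "\<And>a b. 0 \<le> f a b" "\<And>a b. f a b \<le> 1" "\<And>a b. (a, b) \<in> parcs G - Rob \<Longrightarrow> f a b \<le> \<xi>" and "0 \<le> \<xi>"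
  shows "dg.avg (\<lambda>a. dg.avg (\<lambda>b. of_bool ((a, b) \<in> parcs G) * f a b)) \<le> 2 * \<xi>"
proof -
  have "dg.avg (\<lambda>a. dg.avg (\<lambda>b. of_bool ((a, b) \<in> parcs G) * f a b))
      \<le> dg.avg (\<lambda>a. dg.avg (\<lambda>b. of_bool ((a, b) \<in> Rob) + \<xi>))"
  proof (intro dg.avg_mono)
    fix a b
    consider "(a, b) \<in> Rob" | "(a, b) \<in> parcs G - Rob" | "(a, b) \<notin> parcs G" by blast
    then show "of_bool ((a, b) \<in> parcs G) * f a b \<le> of_bool ((a, b) \<in> Rob) + \<xi>"
    proof cases
      case 1 then show ?thesis using Rob f(2)[of a b] \<open>0 \<le> \<xi>\<close> by auto
    qed (use f(3)[of a b] \<open>0 \<le> \<xi>\<close> in auto)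
  qed
  also have "\<dots> = dg.avg (\<lambda>a. dg.avg (\<lambda>b. of_bool ((a, b) \<in> Rob))) + \<xi>"
    by (simp only: dg.avg_add dg.avg_const)
  also have "dg.avg (\<lambda>a. dg.avg (\<lambda>b. of_bool ((a, b) \<in> Rob))) = real (card Rob) / real (card V) ^ 2"
  proof -
    have "Rob = {(a, b). a \<in> V \<and> b \<in> V \<and> (a, b) \<in> Rob}"
      using Rob in_arcsD1 in_arcsD2 by auto
    then have "real (card Rob) = real (card {(a, b). a \<in> V \<and> b \<in> V \<and> (a, b) \<in> Rob})"
      by (rule arg_cong)
    also have "\<dots> = (\<Sum>a\<in>V. \<Sum>b\<in>V. of_bool ((a, b) \<in> Rob))"
      by (rule card_rel_of_bool) (rule dg.fin)+
    finally show ?thesis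
      by (simp only: dg.avg_def sum_divide_distrib[symmetric] divide_divide_eq_left power2_eq_square)
  qed
  also have "real (card Rob) / real (card V) ^ 2 \<le> \<xi>"
    using few dg.card_pos dg.ne by (subst pos_divide_le_eq) simp_all
  finally show ?thesis by simp
qed

lemma codeg_small:
  assumes "a \<in> V" "b \<in> V" "dg.D 3 a b < \<xi>\<^sup>2 / 16" "0 \<le> \<xi>"
  shows "dg.codeg a b \<le> \<xi>"
proof -
  have "(dg.codeg a b)\<^sup>2 \<le> \<xi>\<^sup>2" using dg.codeg_square[OF assms(1,2)] assms(3) by linarith
  then show ?thesis by (rule power2_le_imp_le) fact
qed

lemma arcs_V: "(a, b) \<in> parcs G \<Longrightarrow> a \<in> V \<and> b \<in> V"
  using in_arcsD1 in_arcsD2 by blast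

lemma closed_walks_2_le:
  assumes Rob: "Rob \<subseteq> parcs G" "real (card Rob) \<le> \<xi> * real (card V) ^ 2" "0 \<le> \<xi>"
    "\<And>a b. (a, b) \<in> parcs G - Rob \<Longrightarrow> dg.D 3 a b < \<xi>\<^sup>2 / 16"
  shows "dg.closed_walks 2 \<le> 2 * \<xi>"
  unfolding dg.closed_walks_2[symmetric]
  by (rule avg_arcs_le[OF Rob(1,2)]) (use Rob codeg_small arcs_V in auto)

lemma closed_walks_odd_le:
  assumes Rob: "Rob \<subseteq> parcs G" "real (card Rob) \<le> \<xi> * real (card V) ^ 2" "0 \<le> \<xi>"
    "\<And>a b. (a, b) \<in> parcs G - Rob \<Longrightarrow> dg.D k a b \<le> \<xi>"
  shows "dg.closed_walks (Suc k) \<le> 2 * \<xi>"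
proof -
  have "dg.closed_walks (Suc k) = dg.avg (\<lambda>a. dg.avg (\<lambda>b. of_bool ((a, b) \<in> parcs G) * dg.D k a b))"
    using dg.closed_walks_add[of 0 k] by (simp add: dg.D.simps(1) dg.D_sym[of k b a for a b])
  also have "\<dots> \<le> 2 * \<xi>"
    by (rule avg_arcs_le[OF Rob(1,2)]) (use Rob in auto)
  finally show ?thesis .
qed

end

lemma copy_arc: "\<phi> \<in> labelled_copies H G \<Longrightarrow> (u, w) \<in> parcs H \<Longrightarrow> (\<phi> u, \<phi> w) \<in> parcs G"
  unfolding labelled_copies_def by blast

context critical_graph begin

abbreviation "rest \<equiv> card (pverts H - {x, y})"

text \<open>A graph on \<open>x\<close> and \<open>y\<close> alone is 2-colourable. This makes the
  exponent \<open>rest - 1\<close> of the non-injective maps genuinely smaller than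
  \<open>rest\<close>.\<close>

lemma t_pos: "0 < rest"
proof (rule ccontr)
  assume "\<not> 0 < rest"
  then have "pverts H - {x, y} = {}" using pair_finite_verts by simp
  then have V: "pverts H \<subseteq> {x, y}" by blast
  define d where "d u = (if u = x then 0 else 1::nat)" for u
  have "d u \<noteq> d w" if "(u, w) \<in> parcs H" for u w
    using V in_arcsD1[OF that] in_arcsD2[OF that] no_loops'[of u] that by (auto simp: d_def)
  moreover have "d ` pverts H \<subseteq> {..<2}" by (auto simp: d_def)
  ultimately have "proper_colouring H 2 d"
    unfolding proper_colouring_def by blast
  then show False using no_2_colouring by blast
qed

text \<open>The value of \<open>\<xi>\<close> just violates the conclusion of
  \<open>pentagon_dense_edge\<close>, so a copy without robust arcs cannot exist when
  \<open>Rob\<close> is small.\<close>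

lemma robust_arcs_pentagon:
  assumes "host_graph G \<alpha>"
    and pent: "(x, u) \<in> parcs H" "(u, m) \<in> parcs H" "(m, s) \<in> parcs H" "(s, y) \<in> parcs H"
    and \<xi>: "\<xi> = \<alpha> ^ 7 / 20"
  shows "\<exists>Rob \<subseteq> parcs G.
    (\<forall>(a, b) \<in> Rob. (\<xi>\<^sup>2 / 16) ^ (rest * rest) * real (card (pverts G)) ^ rest
      \<le> real (card (host_graph.edge_homs G H x y a b))) \<and>
    (\<xi> * real (card (pverts G)) ^ 2 \<le> real (card Rob) \<or>
     (\<forall>\<phi> \<in> labelled_copies H G. \<exists>(u, w) \<in> parcs H. (\<phi> u, \<phi> w) \<in> Rob))"
proof -
  interpret G: host_graph G \<alpha> by fact
  define Rob where "Rob = {(a, b) \<in> parcs G. \<xi>\<^sup>2 / 16 \<le> G.dg.D 3 a b}"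
  have xi: "0 < \<xi>" "\<xi> \<le> 1"
    using G.\<alpha>_pos G.dg.\<alpha>_le_1 power_le_one[of \<alpha> 7] by (auto simp: \<xi>)
  have eta: "\<xi>\<^sup>2 / 16 \<le> \<xi>"
    using xi mult_left_le[of \<xi> \<xi>] by (simp add: power2_eq_square)
  have nonrob: "G.dg.D 3 a b < \<xi>\<^sup>2 / 16" if "(a, b) \<in> parcs G - Rob" for a b
    using that by (auto simp: Rob_def)
  show ?thesis
  proof (intro exI[of _ Rob] conjI)
    show "Rob \<subseteq> parcs G" by (auto simp: Rob_def)
    show "\<forall>(a, b) \<in> Rob. (\<xi>\<^sup>2 / 16) ^ (rest * rest) * real (card (pverts G)) ^ rest \<le> real (card (G.edge_homs H x y a b))"
    proof clarify
      fix a b assume "(a, b) \<in> Rob"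
      then show "(\<xi>\<^sup>2 / 16) ^ (rest * rest) * real (card (pverts G)) ^ rest \<le> real (card (G.edge_homs H x y a b))"
        by (intro G.edge_homs_pattern4[OF pair_graph_axioms xy _ path_pattern4]) (auto simp: Rob_def)
    qed
    show "\<xi> * real (card (pverts G)) ^ 2 \<le> real (card Rob) \<or>
     (\<forall>\<phi> \<in> labelled_copies H G. \<exists>(u, w) \<in> parcs H. (\<phi> u, \<phi> w) \<in> Rob)"
    proof (rule ccontr)
      assume n: "\<not> (\<xi> * real (card (pverts G)) ^ 2 \<le> real (card Rob) \<or>
        (\<forall>\<phi> \<in> labelled_copies H G. \<exists>(u, w) \<in> parcs H. (\<phi> u, \<phi> w) \<in> Rob))"
      then obtain \<phi> where \<phi>: "\<phi> \<in> labelled_copies H G" "\<And>u w. (u, w) \<in> parcs H \<Longrightarrow> (\<phi> u, \<phi> w) \<notin> Rob"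
        by blast
      have e: "\<phi> u \<in> pverts G \<and> \<phi> w \<in> pverts G \<and> G.dg.D 3 (\<phi> u) (\<phi> w) \<le> \<xi> \<and> G.dg.codeg (\<phi> u) (\<phi> w) \<le> \<xi>"
        if "(u, w) \<in> parcs H" for u w
      proof -
        have a: "(\<phi> u, \<phi> w) \<in> parcs G - Rob" using copy_arc[OF \<phi>(1) that] \<phi>(2)[OF that] by blast
        then have V: "\<phi> u \<in> pverts G" "\<phi> w \<in> pverts G" using G.arcs_V by blast+
        show ?thesis using nonrob[OF a] eta G.codeg_small[OF V nonrob[OF a]] xi V by auto
      qed
      have "G.dg.closed_walks 2 \<le> 2 * \<xi>"
        using n xi nonrob by (intro G.closed_walks_2_le[of Rob]) (auto simp: Rob_def)
      then have "\<alpha> ^ 7 \<le> 19 * \<xi>"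
        using e[OF pent(1)] e[OF pent(2)] e[OF pent(3)] e[OF pent(4)] e[OF sym[OF xy]]
        by (intro G.dg.pentagon_dense_edge[of "\<phi> x" "\<phi> u" "\<phi> m" "\<phi> s" "\<phi> y"]) auto
      then show False using xi by (simp add: \<xi>)
    qed
  qed
qed

text \<open>Both patterns are available here, so \<open>Rob\<close> may collect arcs dense in walks
  of length 4 or of length 6, and both densities are small elsewhere.\<close>

lemma robust_arcs_no_pentagon:
  assumes no_pentagon: "\<And>u m rest. (x, u) \<in> parcs H \<Longrightarrow> (u, m) \<in> parcs H \<Longrightarrow> (m, rest) \<in> parcs H \<Longrightarrow>
    (rest, y) \<in> parcs H \<Longrightarrow> m = x \<or> m = y"
    and f: "f 0 = x" "f (2 * l + 2) = y" "\<And>i. i < 2 * l + 2 \<Longrightarrow> (f i, f (Suc i)) \<in> parcs H"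
    and "host_graph G \<alpha>"
    and \<xi>: "0 < \<xi>" "\<xi> \<le> 1" "odd_walk_const \<alpha> l * \<xi> < 1 / 16"
  shows "\<exists>Rob \<subseteq> parcs G.
    (\<forall>(a, b) \<in> Rob. (\<xi>\<^sup>2 / 16) ^ (rest * rest) * real (card (pverts G)) ^ rest
      \<le> real (card (host_graph.edge_homs G H x y a b))) \<and>
    (\<xi> * real (card (pverts G)) ^ 2 \<le> real (card Rob) \<or>
     (\<forall>\<phi> \<in> labelled_copies H G. \<exists>(u, w) \<in> parcs H. (\<phi> u, \<phi> w) \<in> Rob))"
proof -
  interpret G: host_graph G \<alpha> by fact
  define Rob where "Rob = {(a, b) \<in> parcs G. \<xi>\<^sup>2 / 16 \<le> G.dg.D 3 a b \<or> \<xi>\<^sup>2 / 16 \<le> G.dg.D 5 a b}"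
  have eta: "\<xi>\<^sup>2 / 16 \<le> \<xi>"
    using \<xi> mult_left_le[of \<xi> \<xi>] by (simp add: power2_eq_square)
  have nonrob: "G.dg.D 3 a b < \<xi>\<^sup>2 / 16" "G.dg.D 5 a b < \<xi>\<^sup>2 / 16" if "(a, b) \<in> parcs G - Rob" for a b
    using that by (auto simp: Rob_def)
  show ?thesis
  proof (intro exI[of _ Rob] conjI)
    show Rsub: "Rob \<subseteq> parcs G" by (auto simp: Rob_def)
    show "\<forall>(a, b) \<in> Rob. (\<xi>\<^sup>2 / 16) ^ (rest * rest) * real (card (pverts G)) ^ rest \<le> real (card (G.edge_homs H x y a b))"
    proof clarify
      fix a b assume "(a, b) \<in> Rob"
      then have ab: "(a, b) \<in> parcs G" and "\<xi>\<^sup>2 / 16 \<le> G.dg.D 3 a b \<or> \<xi>\<^sup>2 / 16 \<le> G.dg.D 5 a b"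
        by (auto simp: Rob_def)
      then show "(\<xi>\<^sup>2 / 16) ^ (rest * rest) * real (card (pverts G)) ^ rest \<le> real (card (G.edge_homs H x y a b))"
        using G.edge_homs_pattern4[OF pair_graph_axioms xy ab path_pattern4 _ _ refl, where \<eta> = "\<xi>\<^sup>2 / 16"]
          G.edge_homs_pattern6[OF pair_graph_axioms xy ab path_pattern6[OF no_pentagon] _ _ refl, where \<eta> = "\<xi>\<^sup>2 / 16"]
        by auto
    qed
    show "\<xi> * real (card (pverts G)) ^ 2 \<le> real (card Rob) \<or>
     (\<forall>\<phi> \<in> labelled_copies H G. \<exists>(u, w) \<in> parcs H. (\<phi> u, \<phi> w) \<in> Rob)"
    proof (rule ccontr)
      assume n: "\<not> (\<xi> * real (card (pverts G)) ^ 2 \<le> real (card Rob) \<or>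
        (\<forall>\<phi> \<in> labelled_copies H G. \<exists>(u, w) \<in> parcs H. (\<phi> u, \<phi> w) \<in> Rob))"
      then have few: "real (card Rob) \<le> \<xi> * real (card (pverts G)) ^ 2" by linarith
      from n obtain \<phi> where \<phi>: "\<phi> \<in> labelled_copies H G" "\<And>u w. (u, w) \<in> parcs H \<Longrightarrow> (\<phi> u, \<phi> w) \<notin> Rob"
        by blast
      have e: "\<phi> u \<in> pverts G \<and> \<phi> w \<in> pverts G \<and> G.dg.D 3 (\<phi> u) (\<phi> w) \<le> \<xi> \<and> G.dg.D 5 (\<phi> u) (\<phi> w) \<le> \<xi>"
        if "(u, w) \<in> parcs H" for u w
      proof -
        have a: "(\<phi> u, \<phi> w) \<in> parcs G - Rob" using copy_arc[OF \<phi>(1) that] \<phi>(2)[OF that] by blast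
        show ?thesis using nonrob[OF a] eta G.arcs_V[of "\<phi> u" "\<phi> w"] a by auto
      qed
      have c2: "G.dg.closed_walks 2 \<le> 2 * \<xi>"
        using \<xi> nonrob by (intro G.closed_walks_2_le[OF Rsub few]) auto
      have D: "G.dg.D 3 a b \<le> \<xi>" "G.dg.D 5 a b \<le> \<xi>" if "(a, b) \<in> parcs G - Rob" for a b
        using nonrob[OF that] eta by linarith+
      have "G.dg.closed_walks (Suc 3) \<le> 2 * \<xi>"
        using \<xi>(1) by (intro G.closed_walks_odd_le[OF Rsub few] D(1)) simp_all
      moreover have "G.dg.closed_walks (Suc 5) \<le> 2 * \<xi>"
        using \<xi>(1) by (intro G.closed_walks_odd_le[OF Rsub few] D(2)) simp_all
      ultimately have c46: "G.dg.closed_walks 4 \<le> 2 * \<xi>" "G.dg.closed_walks 6 \<le> 2 * \<xi>" by simp_all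
      \<comment> \<open>Past the end of the walk \<open>v\<close> stays at the image of
        \<open>y\<close>, so every \<open>v i\<close> is a vertex of \<open>G\<close>.\<close>
      define v where "v i = \<phi> (f (min i (2 * l + 2)))" for i
      have fV: "f i \<in> pverts H" if "i \<le> 2 * l + 2" for i
        using that f xyV in_arcsD1[OF f(3)[of i]] by (cases "i = 2 * l + 2") auto
      have vV: "v i \<in> pverts G" for i
        using \<phi>(1) fV[of "min i (2 * l + 2)"] by (auto simp: v_def labelled_copies_def)
      have vE: "G.dg.D 3 (v i) (v (Suc i)) \<le> \<xi> \<and> G.dg.D 5 (v i) (v (Suc i)) \<le> \<xi>" if "i < 2 * l + 2" for i
        using e[OF f(3)[OF that]] that by (simp add: v_def min_def)
      have vl: "G.dg.D 3 (v (2 * l + 2)) (v 0) \<le> \<xi>" "G.dg.D 5 (v (2 * l + 2)) (v 0) \<le> \<xi>"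
        using e[OF sym[OF xy]] f by (simp_all add: v_def)
      have "1 / 16 \<le> odd_walk_const \<alpha> l * \<xi>"
        by (rule G.dg.odd_walk_dense_edge[OF vV vE vl c2 c46])
      then show False using \<xi> by simp
    qed
  qed
qed

text \<open>The constants precede \<open>G\<close>: besides \<open>\<alpha>\<close> they depend only
  on \<open>H\<close>, through \<open>rest\<close> and the length of a fixed odd closed
  walk.\<close>

lemma robust_arcs:
  assumes "\<alpha> > 0"
  shows "\<exists>\<xi>>0. \<exists>\<kappa>>0. \<forall>G :: nat pair_pre_digraph. host_graph G \<alpha> \<longrightarrow> (\<exists>Rob \<subseteq> parcs G.
    (\<forall>(a, b) \<in> Rob. \<kappa> * real (card (pverts G)) ^ rest
      \<le> real (card (host_graph.edge_homs G H x y a b))) \<and>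
    (\<xi> * real (card (pverts G)) ^ 2 \<le> real (card Rob) \<or>
     (\<forall>\<phi> \<in> labelled_copies H G. \<exists>(u, w) \<in> parcs H. (\<phi> u, \<phi> w) \<in> Rob)))"
proof (cases "\<exists>u m s. (x, u) \<in> parcs H \<and> (u, m) \<in> parcs H \<and> (m, s) \<in> parcs H \<and> (s, y) \<in> parcs H \<and> m \<noteq> x \<and> m \<noteq> y")
  case True
  then obtain u m s where p: "(x, u) \<in> parcs H" "(u, m) \<in> parcs H" "(m, s) \<in> parcs H" "(s, y) \<in> parcs H"
    by blast
  define \<xi> where "\<xi> = \<alpha> ^ 7 / 20"
  have xi: "\<xi> > 0" using assms by (simp add: \<xi>_def)
  show ?thesis
  proof (rule exI[of _ \<xi>], intro conjI, fact xi, rule exI[of _ "(\<xi>\<^sup>2 / 16) ^ (rest * rest)"], intro conjI allI impI)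
    show "(\<xi>\<^sup>2 / 16) ^ (rest * rest) > 0" using xi by simp
  qed (erule robust_arcs_pentagon[OF _ p \<xi>_def])
next
  case False
  obtain f l where f: "f 0 = x" "f (2 * l + 2) = y" "\<And>i. i < 2 * l + 2 \<Longrightarrow> (f i, f (Suc i)) \<in> parcs H"
    using even_walk by metis
  \<comment> \<open>32 instead of 16 makes the contradiction strict; the cap 1 ensures that
    \<open>\<xi>\<^sup>2 / 16\<close> is at most \<open>\<xi>\<close>.\<close>
  define \<xi> where "\<xi> = min 1 (1 / (32 * odd_walk_const \<alpha> l))"
  have M: "odd_walk_const \<alpha> l > 0" by (rule odd_walk_const_pos[OF assms])
  have xi: "0 < \<xi>" "\<xi> \<le> 1" using M by (auto simp: \<xi>_def)
  have "odd_walk_const \<alpha> l * \<xi> \<le> odd_walk_const \<alpha> l * (1 / (32 * odd_walk_const \<alpha> l))" using M by (intro mult_left_mono) (auto simp: \<xi>_def)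
  then have xi3: "odd_walk_const \<alpha> l * \<xi> < 1 / 16" using M by simp
  show ?thesis
  proof (rule exI[of _ \<xi>], intro conjI, fact xi(1), rule exI[of _ "(\<xi>\<^sup>2 / 16) ^ (rest * rest)"], intro conjI allI impI)
    show "(\<xi>\<^sup>2 / 16) ^ (rest * rest) > 0" using xi by simp
  qed (rule robust_arcs_no_pentagon[OF _ f _ xi xi3], use False in blast, assumption)
qed

end

section \<open>From robust edges to the linear removal bound\<close>

lemma card_copies_ge:
  assumes "pair_graph G" "pair_graph H" "Rob \<subseteq> parcs G"
    and "\<And>a b. (a, b) \<in> Rob \<Longrightarrow> K \<le> real (card {f \<in> labelled_copies H G. f x = a \<and> f y = b})"
  shows "real (card Rob) * K \<le> real (card (labelled_copies H G))"
proof -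
  interpret G: pair_graph G by fact
  interpret H: pair_graph H by fact
  let ?N = "\<lambda>p. {f \<in> labelled_copies H G. f x = fst p \<and> f y = snd p}"
  have finL: "finite (labelled_copies H G)"
    using H.pair_finite_verts G.pair_finite_verts by (auto simp: labelled_copies_def
        intro!: finite_subset[OF _ finite_PiE[of "pverts H" "\<lambda>_. pverts G"]])
  have finR: "finite Rob" using assms(3) G.pair_finite_arcs finite_subset by blast
  have "real (card Rob) * K \<le> (\<Sum>p\<in>Rob. real (card (?N p)))"
    using sum_bounded_below[of Rob K "\<lambda>p. real (card (?N p))"] assms(4) by auto
  also have "\<dots> = real (card (\<Union>p\<in>Rob. ?N p))"
    using finR finL by (subst card_UN_disjoint) auto
  also have "\<dots> \<le> real (card (labelled_copies H G))"
    using finL by (intro of_nat_mono card_mono) auto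
  finally show ?thesis .
qed

lemma card_robust_ge:
  assumes "pair_graph G" "Rob \<subseteq> parcs G" "edge_disjoint_copies H G F"
    and hit: "\<forall>\<phi> \<in> labelled_copies H G. \<exists>(u, w) \<in> parcs H. (\<phi> u, \<phi> w) \<in> Rob"
  shows "card F \<le> card Rob"
proof -
  interpret G: pair_graph G by fact
  have "\<exists>p. p \<in> map_prod f f ` parcs H \<and> p \<in> Rob" if "f \<in> F" for f
    using hit that assms(3) by (force simp: edge_disjoint_copies_def)
  then obtain r where r: "\<And>f. f \<in> F \<Longrightarrow> r f \<in> map_prod f f ` parcs H" "\<And>f. f \<in> F \<Longrightarrow> r f \<in> Rob"
    by metis
  have "inj_on r F"
  proof (rule inj_onI, rule ccontr)
    fix f g assume fg: "f \<in> F" "g \<in> F" "r f = r g" "f \<noteq> g"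
    then have "map_prod f f ` parcs H \<inter> map_prod g g ` parcs H = {}"
      using assms(3) by (auto simp: edge_disjoint_copies_def disjoint_family_on_def)
    then show False using r(1)[OF fg(1)] r(1)[OF fg(2)] fg(3) by (metis IntI empty_iff)
  qed
  moreover have "finite Rob" using assms(2) G.pair_finite_arcs finite_subset by blast
  ultimately show ?thesis using r(2) by (intro card_inj_on_le[of r]) auto
qed

lemma removal_bound_linear:
  assumes "critical_graph H x y c" "\<alpha> > 0"
  shows "\<exists>\<mu>>0. \<mu> \<le> 1 \<and> (\<forall>\<epsilon>. 0 < \<epsilon> \<and> \<epsilon> \<le> 1 \<longrightarrow> removal_bound \<epsilon> H (1 / 4 + \<alpha>) (\<mu> * \<epsilon>))"
proof -
  interpret critical_graph H x y c by fact
  let ?h = "card (pverts H)"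
  obtain \<xi> \<kappa> where pos: "\<xi> > 0" "\<kappa> > 0" and rob: "\<And>G :: nat pair_pre_digraph. host_graph G \<alpha> \<Longrightarrow> (\<exists>Rob \<subseteq> parcs G.
    (\<forall>(a, b) \<in> Rob. \<kappa> * real (card (pverts G)) ^ rest
      \<le> real (card (host_graph.edge_homs G H x y a b))) \<and>
    (\<xi> * real (card (pverts G)) ^ 2 \<le> real (card Rob) \<or>
     (\<forall>\<phi> \<in> labelled_copies H G. \<exists>(u, w) \<in> parcs H. (\<phi> u, \<phi> w) \<in> Rob)))"
    using robust_arcs[OF assms(2)] by blast
  have h: "?h = rest + 2"
  proof -
    have "card {x, y} \<le> ?h" using xyV pair_finite_verts by (intro card_mono) auto
    then show ?thesis using xyV pair_finite_verts x_neq_y by (simp add: card_Diff_subset)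
  qed
  \<comment> \<open>From this order on, non-injective maps cost at most half of the count
    \<open>\<kappa> * real n ^ rest\<close>.\<close>
  define N where "N = 2 * real ?h ^ 2 / \<kappa> + 1"
  have N1: "N \<ge> 1" using pos by (simp add: N_def)
  \<comment> \<open>The last entry serves orders below \<open>N\<close>: there
    \<open>\<mu> * real n ^ rest\<close> is at most 1 and the copies in \<open>F\<close> alone
    suffice. The entry 1 keeps \<open>\<mu> * \<epsilon>\<close> in the range of
    \<open>removal_delta\<close>.\<close>
  define \<mu> where "\<mu> = min 1 (min (min 1 \<xi> * (\<kappa> / 2)) ((1 / N) ^ rest))"
  have mu: "0 < \<mu>" "\<mu> \<le> 1" using pos N1 by (auto simp: \<mu>_def)
  have "removal_bound \<epsilon> H (1 / 4 + \<alpha>) (\<mu> * \<epsilon>)" if eps: "0 < \<epsilon>" "\<epsilon> \<le> 1" for \<epsilon>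
    unfolding removal_bound_def
  proof (intro allI impI, elim conjE exE)
    fix G :: "nat pair_pre_digraph" and n F
    assume G: "pair_graph G" "card (pverts G) = n"
      and deg: "\<forall>v\<in>pverts G. (1 / 4 + \<alpha>) * real n \<le> real (out_degree G v)"
      and F: "edge_disjoint_copies H G F" "\<epsilon> * real n ^ 2 \<le> real (card F)"
    interpret G: pair_graph G by fact
    have finL: "finite (labelled_copies H G)"
      using pair_finite_verts G.pair_finite_verts by (auto simp: labelled_copies_def
          intro!: finite_subset[OF _ finite_PiE[of "pverts H" "\<lambda>_. pverts G"]])
    show "\<mu> * \<epsilon> * real n ^ ?h \<le> real (card (labelled_copies H G))"
    proof (cases "real n < N")
      case True
      have "\<mu> * \<epsilon> * real n ^ ?h = \<epsilon> * real n ^ 2 * (\<mu> * real n ^ rest)"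
        by (simp add: h power_add mult_ac power2_eq_square)
      also have "\<dots> \<le> \<epsilon> * real n ^ 2 * 1"
      proof (rule mult_left_mono)
        have "\<mu> * real n ^ rest \<le> (1 / N) ^ rest * N ^ rest"
          using True N1 mu by (intro mult_mono power_mono) (auto simp: \<mu>_def)
        also have "\<dots> = 1" using N1 by (simp flip: power_mult_distrib)
        finally show "\<mu> * real n ^ rest \<le> 1" .
      qed (use eps in simp)
      also have "\<dots> \<le> real (card F)" using F(2) by simp
      also have "\<dots> \<le> real (card (labelled_copies H G))"
        using F(1) finL by (intro of_nat_mono card_mono) (auto simp: edge_disjoint_copies_def)
      finally show ?thesis .
    next
      case False
      then have n0: "real n > 0" and nN: "2 * real ?h ^ 2 / \<kappa> \<le> real n"
        using N1 by (auto simp: N_def)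
      have host: "host_graph G \<alpha>"
      proof
        show "pverts G \<noteq> {}" using G n0 by auto
      qed (use assms(2) deg G(2) in auto)
      interpret GH: host_graph G \<alpha> by (rule host)
      obtain Rob where R: "Rob \<subseteq> parcs G"
        and homs: "\<And>a b. (a, b) \<in> Rob \<Longrightarrow> \<kappa> * real n ^ rest \<le> real (card (GH.edge_homs H x y a b))"
        and alt: "\<xi> * real n ^ 2 \<le> real (card Rob) \<or>
          (\<forall>\<phi> \<in> labelled_copies H G. \<exists>(u, w) \<in> parcs H. (\<phi> u, \<phi> w) \<in> Rob)"
        using rob[OF host] G(2) by blast
      have "\<kappa> / 2 * real n ^ rest \<le> real (card {f \<in> labelled_copies H G. f x = a \<and> f y = b})"
        if ab: "(a, b) \<in> Rob" for a b
      proof -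
        have abG: "(a, b) \<in> parcs G" using ab R by blast
        have "\<kappa> * real n ^ rest - real (?h ^ 2 * n ^ (rest - 1)) \<le>
            real (card {f \<in> labelled_copies H G. f x = a \<and> f y = b})"
          using labelled_copies_through_edge[OF pair_graph_axioms G(1) xy abG refl, of "\<kappa> * real n ^ rest"]
            homs[OF ab] G(2) by (simp add: GH.edge_homs_def)
        moreover have "real (?h ^ 2 * n ^ (rest - 1)) \<le> \<kappa> / 2 * real n ^ rest"
        proof -
          have "real ?h ^ 2 \<le> \<kappa> / 2 * real n" using nN pos by (simp add: pos_divide_le_eq mult_ac)
          then have "real ?h ^ 2 * real n ^ (rest - 1) \<le> \<kappa> / 2 * real n * real n ^ (rest - 1)"
            by (rule mult_right_mono) simp
          also have "\<dots> = \<kappa> / 2 * real n ^ rest" 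
            using power_minus_mult[OF t_pos, of "real n"] by (metis mult.assoc mult.commute)
          finally show ?thesis by simp
        qed
        ultimately show ?thesis by linarith
      qed
      then have L: "real (card Rob) * (\<kappa> / 2 * real n ^ rest) \<le> real (card (labelled_copies H G))"
        by (rule card_copies_ge[OF G(1) pair_graph_axioms R])
      have Rge: "min 1 \<xi> * (\<epsilon> * real n ^ 2) \<le> real (card Rob)"
        using alt
      proof
        assume a: "\<xi> * real n ^ 2 \<le> real (card Rob)"
        have "min 1 \<xi> * (\<epsilon> * real n ^ 2) \<le> \<xi> * (1 * real n ^ 2)"
          using eps pos by (intro mult_mono) auto
        then show ?thesis using a by simp
      next
        assume "\<forall>\<phi> \<in> labelled_copies H G. \<exists>(u, w) \<in> parcs H. (\<phi> u, \<phi> w) \<in> Rob"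
        then have "real (card F) \<le> real (card Rob)"
          using card_robust_ge[OF G(1) R F(1)] by simp
        moreover have "min 1 \<xi> * (\<epsilon> * real n ^ 2) \<le> 1 * (\<epsilon> * real n ^ 2)"
          using eps by (intro mult_right_mono) auto
        ultimately show ?thesis using F(2) by simp
      qed
      have "\<mu> * \<epsilon> * real n ^ ?h = \<mu> * (\<epsilon> * real n ^ 2 * real n ^ rest)"
        by (simp add: h power_add mult_ac power2_eq_square)
      also have "\<dots> \<le> (min 1 \<xi> * (\<kappa> / 2)) * (\<epsilon> * real n ^ 2 * real n ^ rest)"
        using eps by (intro mult_right_mono) (auto simp: \<mu>_def)
      also have "\<dots> = min 1 \<xi> * (\<epsilon> * real n ^ 2) * (\<kappa> / 2 * real n ^ rest)" by (simp only: mult_ac)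
      also have "\<dots> \<le> real (card Rob) * (\<kappa> / 2 * real n ^ rest)"
        using pos by (intro mult_right_mono Rge) auto
      finally show ?thesis using L by linarith
    qed
  qed
  then show ?thesis using mu by blast
qed

theorem theorem5p7:
  fixes H :: "'a pair_pre_digraph"
  assumes "pair_graph H"
    and "chromatic_number H = 3"
    and "\<exists>x y. critical_edge H x y"
    and "odd_girth H \<ge> 5"
  shows "delta_lin_rem H \<le> 1 / 4"
proof -
  obtain x y where "critical_edge H x y" using assms(3) by blast
  then obtain c where crit: "critical_graph H x y c"
    using critical_graph_exists[OF assms(1,2) _ assms(4)] by blast
  let ?S = "{\<gamma> \<in> {0..1}. \<exists>\<mu>>0. \<forall>\<epsilon>. 0 < \<epsilon> \<and> \<epsilon> \<le> 1 \<longrightarrow> removal_delta \<epsilon> H \<gamma> \<ge> \<mu> * \<epsilon>}"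
  have bdd: "bdd_below ?S" by (rule bdd_belowI[of _ 0]) auto
  show ?thesis
  proof (rule field_le_epsilon)
    fix e :: real assume e: "e > 0"
    \<comment> \<open>The cap keeps \<open>1 / 4 + \<alpha>\<close> in the unit interval over which
      the infimum is taken.\<close>
    define \<alpha> where "\<alpha> = min e (1 / 2)"
    have a: "\<alpha> > 0" "\<alpha> \<le> e" "\<alpha> \<le> 1 / 2" using e by (auto simp: \<alpha>_def)
    obtain \<mu> where \<mu>: "\<mu> > 0" "\<mu> \<le> 1"
      and b: "\<And>\<epsilon>. 0 < \<epsilon> \<Longrightarrow> \<epsilon> \<le> 1 \<Longrightarrow> removal_bound \<epsilon> H (1 / 4 + \<alpha>) (\<mu> * \<epsilon>)"
      using removal_bound_linear[OF crit a(1)] by blast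
    have "\<mu> * \<epsilon> \<le> removal_delta \<epsilon> H (1 / 4 + \<alpha>)" if "0 < \<epsilon>" "\<epsilon> \<le> 1" for \<epsilon>
      using that \<mu> b by (intro removal_delta_is_maximum(2)) (auto intro!: mult_le_one)
    then have "1 / 4 + \<alpha> \<in> ?S" using a \<mu> by auto
    then have "delta_lin_rem H \<le> 1 / 4 + \<alpha>"
      unfolding delta_lin_rem_def by (rule cInf_lower[OF _ bdd])
    then show "delta_lin_rem H \<le> 1 / 4 + e" using a by simp
  qed
qed

end
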